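(* Let $R_0$ be a commutative unital ring, $V$ a free $R_0$-module of finite rank $n$, $R=R_0[[x_1,\dots,x_n]]$ the ring of formal functions on $V$, $\mathfrak{m}=(x_1,\dots,x_n)$, and $w\in\mathfrak{m}^2$. Let $\mathcal{B}_0^{\mathrm{min}}$ be the minimal model, described in the context, of the endomorphism dg-algebra $\mathcal{B}_0$ of the matrix factorisation $\mathscr{E}_0$ of $w$. Then the disc potential of $\mathcal{B}_0^{\mathrm{min}}$ is $w$ itself.
   Context: $A_\infty$-conventions (Seidel): $\sum(-1)^{\maltese_i}\mu^{k-j+1}(a_k,\dots,\mu^j(a_{i+j},\dots,a_{i+1}),a_i,\dots,a_1)=0$, $\maltese_i=|a_1|+\dots+|a_i|-i$. A dg-algebra is an $A_\infty$-algebra via $\mathrm{d}a=(-1)^{|a|}\mu^1(a)$, $a_2a_1=(-1)^{|a_1|}\mu^2(a_2,a_1)$, $\mu^{\ge3}=0$. Notation. $v_1,\dots,v_n$ is a basis of $V$, $x_i$ the dual coordinates, $v_i^\vee$ the dual basis of $V^\vee$; $E=\Lambda^*V$, $E_R=R\otimes_{R_0}E$; $\bm{v}=\sum_ix_iv_i$. $R_p\subset R$ is the module of homogeneous polynomials of degree $p$. Elements $u\in R\otimes V$, $\theta\in R\otimes V^\vee$ are identified with the endomorphisms $u\wedge\bullet$, $\theta\lrcorner\bullet$ (contraction) of $E_R$. Via $\alpha\otimes\beta\mapsto(\alpha\wedge\bullet)\circ(\beta\lrcorner\bullet)$ we have $\operatorname{End}_R(E_R)=\bigoplus_{q,r}R\otimes\Lambda^qV\otimes\Lambda^rV^\vee$;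 the $(q,r)$ summand has bidegree $(q,r)$ and $\mathbb{Z}$-degree $q-r$. Let $\pi:\operatorname{End}_R(E_R)\to E$ send $f$ to $f(1)$ mod $\mathfrak{m}$ (projection onto $R_0\otimes\Lambda^*V\otimes\Lambda^0V^\vee$). Put $K^{s,q}=\bigoplus_{p+r=s}R_p\otimes\Lambda^qV\otimes\Lambda^rV^\vee$, so $\ker\pi=\prod_{s\ge1}\bigoplus_qK^{s,q}$. $[\cdot,\cdot]$ is the graded commutator. Construction. (1) Let $\mathrm{d}_1(f)=[f,\bm{v}]$ on $\ker\pi$; it preserves each $K^{s,q}$. Choose $\eta_{-1}:\ker\pi\to\ker\pi$, $R_0$-linear of $\mathbb{Z}$-degree $-1$, given by homotopies on the individual $K^{s,q}$ ($s\ge1$), with $\mathrm{d}_1\eta_{-1}+\eta_{-1}\mathrm{d}_1=-\operatorname{id}$. For $r\in\mathfrak{m}$, $\eta_{-1}(r\operatorname{id}_{E_R})=\sum_im_i(r)v_i^\vee$ for some $m_i(r)\in R$, and $\sum_ix_im_i(r)=-r$. (2) Put $w_i=-m_i(w)\in\mathfrak{m}$, so $w=\sum_ix_iw_i$, and $\lambda_{ij}=m_j(w_i)$, so $w_i=-\sum_j\lambda_{ij}x_j$. Let $\check{\bm{w}}=\sum_iw_iv_i^\vee$. The matrix factorisation $\mathscr{E}_0$ of $w$ is $E_R$ with the odd endomorphism $\mathrm{d}_{\mathscr{E}_0}a=-(\bm{v}\wedge a+\check{\bm{w}}\lrcorner a)$, which squares to $w$. $\mathcal{B}_0$ is the dg-algebra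 $\operatorname{End}_R(E_R)$ with differential $f\mapsto[\mathrm{d}_{\mathscr{E}_0},f]$, so $\mu^1_{\mathcal{B}_0}(f)=[f,\bm{v}+\check{\bm{w}}]$. (3) Let $f_i=v_i+\sum_j\lambda_{ij}v_j^\vee\in\mathcal{B}_0$, and let $\iota:E\to\mathcal{B}_0$ be the $R_0$-linear map sending $v_{i_1}\wedge\dots\wedge v_{i_k}$ ($i_1<\dots<i_k$) to the projection of $f_{i_1}\cdots f_{i_k}$ onto the pieces of bidegree $(q,r)$ with $q+r=k$. Then $\pi\circ\iota=\operatorname{id}_E$ and $\mathcal{B}_0=\operatorname{im}\iota\oplus\ker\pi$ as complexes over $R_0$. (4) On $\ker\pi$ write $\mathrm{d}=\mu^1_{\mathcal{B}_0}=\mathrm{d}_1+\mathrm{d}_{-1}$, $\mathrm{d}_{-1}(f)=[f,\check{\bm{w}}]$. Define inductively $\eta_{-2j-1}=(\mathrm{d}_{-1}\eta_{-2j+1}+\eta_{-2j+1}\mathrm{d}_{-1})\eta_{-1}$ for $j\ge1$, let $\tilde\eta=\sum_{j\ge0}\eta_{-2j-1}$, and let $\eta:\mathcal{B}_0\to\mathcal{B}_0$ be $\tilde\eta-\mathrm{d}\tilde\eta^3\mathrm{d}$ on $\ker\pi$ and $0$ on $\operatorname{im}\iota$. It satisfies $\mu^1_{\mathcal{B}_0}\eta+\eta\mu^1_{\mathcal{B}_0}=\iota\pi-\operatorname{id}$, $\eta\iota=0$, $\pi\eta=0$, $\eta^2=0$. (5) $\mathcal{B}_0^{\mathrm{min}}$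 is the $A_\infty$-algebra over $R_0$ with underlying module $E$, $\mu^1_{\mathrm{min}}=0$ and $\mu^k_{\mathrm{min}}=\pi\circ\mathbf{p}_k\circ\iota^{\otimes k}$ for $k\ge2$, where $\mathbf{p}_2=\mu^2_{\mathcal{B}_0}$, $\mathbf{p}_k(a_k,\dots,a_1)=\sum_{j=1}^{k-1}\mu^2_{\mathcal{B}_0}(\eta\mathbf{p}_{k-j}(a_k,\dots,a_{j+1}),\eta\mathbf{p}_j(a_j,\dots,a_1))$, with $\eta\mathbf{p}_1$ interpreted as the identity. (It is strictly unital, its operations are superfiltered, and their leading terms are the standard ones on $E$.) Disc potential: $\sum_{k\ge2}\sum_{i_1,\dots,i_k}\mu^k_{\mathrm{min}}(v_{i_k},\dots,v_{i_1})x_{i_1}\cdots x_{i_k}$, which takes values in $\Lambda^0V=R_0$, hence is an element of $R$. *)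

theory Defs
  imports
    "HOL-Analysis.Finite_Cartesian_Product"
    "HOL-Library.Multiset"
    "HOL-Library.Groups_Big_Fun"
begin

section \<open>Formal power series in several variables\<close>

text \<open>
  The variables are indexed by \<open>'n\<close>, and the monomial \<open>x\<^sub>i\<^sub>1 \<dots> x\<^sub>i\<^sub>k\<close> is the multiset
  \<open>{#i\<^sub>1, \<dots>, i\<^sub>k#}\<close>; its degree is the size of the multiset.
\<close>

typedef ('a, 'n) mfps = "UNIV :: ('n multiset \<Rightarrow> 'a) set"
  morphisms mcoeff Abs_mfps
  by simp

lemma mcoeff_Abs [simp]: "mcoeff (Abs_mfps f) = f"
  by (simp add: Abs_mfps_inverse)

lemma mfps_eqI: "(\<And>m. mcoeff f m = mcoeff g m) \<Longrightarrow> f = g"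
  by (metis ext mcoeff_inject)

lemma mfps_eq_iff: "f = g \<longleftrightarrow> (\<forall>m. mcoeff f m = mcoeff g m)"
  using mfps_eqI by blast

lemma finite_submultisets: "finite {a. a \<subseteq># (m :: 'n multiset)}"
proof (rule finite_subset)
  show "{a. a \<subseteq># m} \<subseteq> mset ` {xs. set xs \<subseteq> set_mset m \<and> length xs \<le> size m}"
  proof
    fix a assume "a \<in> {a. a \<subseteq># m}"
    then have a: "a \<subseteq># m" by simp
    obtain xs where xs: "mset xs = a" by (metis ex_mset)
    have "set xs \<subseteq> set_mset m" using a xs by (metis set_mset_mono set_mset_mset)
    moreover have "length xs \<le> size m" using a xs by (metis size_mset size_mset_mono)
    ultimately show "a \<in> mset ` {xs. set xs \<subseteq> set_mset m \<and> length xs \<le> size m}"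
      using xs by blast
  qed
  show "finite (mset ` {xs. set xs \<subseteq> set_mset m \<and> length xs \<le> size m})"
    by (intro finite_imageI finite_lists_length_le finite_set_mset)
qed

lemma finite_mset_splits [simp]: "finite {(a, b). a + b = (m :: 'n multiset)}"
proof (rule finite_subset)
  show "{(a, b). a + b = m} \<subseteq> {a. a \<subseteq># m} \<times> {a. a \<subseteq># m}"
    by auto
qed (intro finite_cartesian_product finite_submultisets)

instantiation mfps :: (comm_ring_1, type) comm_ring_1
begin

definition "0 = Abs_mfps (\<lambda>_. 0)"
definition "1 = Abs_mfps (\<lambda>m. if m = {#} then 1 else 0)"
definition "f + g = Abs_mfps (\<lambda>m. mcoeff f m + mcoeff g m)"
definition "f - g = Abs_mfps (\<lambda>m. mcoeff f m - mcoeff g m)"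
definition "- f = Abs_mfps (\<lambda>m. - mcoeff f m)"
definition "f * g = Abs_mfps (\<lambda>m. \<Sum>(a, b) | a + b = m. mcoeff f a * mcoeff g b)"

instance
proof
  fix f g h :: "('a, 'b) mfps"
  show "f * g * h = f * (g * h)"
  proof (rule mfps_eqI)
    fix m
    let ?s = "\<lambda>m :: 'b multiset. {(a, b). a + b = m}"
    let ?F = "\<lambda>((d, c), (a, b)). mcoeff f a * mcoeff g b * mcoeff h c"
    let ?G = "\<lambda>((a, d), (b, c)). mcoeff f a * mcoeff g b * mcoeff h c"
    have "mcoeff (f * g * h) m = (\<Sum>p\<in>?s m. \<Sum>q\<in>?s (fst p). ?F (p, q))"
      by (simp add: times_mfps_def sum_distrib_right case_prod_beta)
    also have "\<dots> = (\<Sum>z\<in>(SIGMA p:?s m. ?s (fst p)). ?F z)"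
      by (subst sum.Sigma) (auto simp: case_prod_beta)
    also have "\<dots> = (\<Sum>z\<in>(SIGMA p:?s m. ?s (snd p)). ?G z)"
      by (rule sum.reindex_bij_witness
          [where i = "\<lambda>((a, d), (b, c)). ((a + b, c), (a, b))"
             and j = "\<lambda>((d, c), (a, b)). ((a, b + c), (b, c))"])
         (auto simp: add.assoc)
    also have "\<dots> = (\<Sum>p\<in>?s m. \<Sum>q\<in>?s (snd p). ?G (p, q))"
      by (subst sum.Sigma) (auto simp: case_prod_beta)
    also have "\<dots> = mcoeff (f * (g * h)) m"
      by (simp add: times_mfps_def sum_distrib_left case_prod_beta mult.assoc)
    finally show "mcoeff (f * g * h) m = mcoeff (f * (g * h)) m" .
  qed
  show "f * g = g * f"
  proof (rule mfps_eqI)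
    fix m
    show "mcoeff (f * g) m = mcoeff (g * f) m"
      unfolding times_mfps_def mcoeff_Abs
      by (rule sum.reindex_bij_witness[where i = prod.swap and j = prod.swap])
         (auto simp: add.commute mult.commute)
  qed
  show "1 * f = f"
  proof (rule mfps_eqI)
    fix m
    have "mcoeff (1 * f) m = (\<Sum>p | fst p + snd p = m. if p = ({#}, m) then mcoeff f m else 0)"
      unfolding times_mfps_def one_mfps_def mcoeff_Abs
      by (rule sum.cong) (auto split: if_splits)
    also have "\<dots> = mcoeff f m"
      using finite_mset_splits[of m] by (subst sum.delta) (simp_all add: case_prod_beta')
    finally show "mcoeff (1 * f) m = mcoeff f m" .
  qed
  show "(f + g) * h = f * h + g * h"
    by (simp add: times_mfps_def plus_mfps_def mfps_eq_iff distrib_right sum.distrib case_prod_beta)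
  show "f + g + h = f + (g + h)" "f + g = g + f" "0 + f = f" "- f + f = 0" "f - g = f + - g"
    by (simp_all add: plus_mfps_def zero_mfps_def uminus_mfps_def minus_mfps_def mfps_eq_iff
        algebra_simps)
  show "(0 :: ('a, 'b) mfps) \<noteq> 1"
    by (auto simp: zero_mfps_def one_mfps_def mfps_eq_iff)
qed

end

definition Const :: "'a::comm_ring_1 \<Rightarrow> ('a, 'n) mfps" where
  "Const c = Abs_mfps (\<lambda>m. if m = {#} then c else 0)"

definition X :: "'n \<Rightarrow> ('a::comm_ring_1, 'n) mfps" where
  "X i = Abs_mfps (\<lambda>m. if m = {#i#} then 1 else 0)"

text \<open>The square of the ideal \<open>\<mm> = (x\<^sub>i | i)\<close>, that is, the ideal \<open>(x\<^sub>i x\<^sub>j | i, j)\<close>.\<close>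

definition max_ideal_sq :: "('a::comm_ring_1, 'n::finite) mfps set" where
  "max_ideal_sq = range (\<lambda>g. \<Sum>i\<in>UNIV. \<Sum>j\<in>UNIV. X i * X j * g i j)"


section \<open>Exterior algebra and endomorphisms\<close>

text \<open>
  For \<open>S = {i\<^sub>1 < \<dots> < i\<^sub>k}\<close> the vector \<open>axis S 1\<close> is \<open>v\<^sub>i\<^sub>1 \<and> \<dots> \<and> v\<^sub>i\<^sub>k\<close>, so the exterior
  algebra of the free module on the \<open>v\<^sub>i\<close> is \<open>'a ^ 'n set\<close>.
  Endomorphisms of the base change to power series are matrices in this basis: composition is
  \<open>**\<close> and application is \<open>*v\<close>.  (The instance of \<open>*\<close> on this type is entrywise and is not used.)
\<close>

type_synonym ('a, 'n) ext = "'a ^ 'n set"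
type_synonym ('a, 'n) extR = "('a, 'n) mfps ^ 'n set"
type_synonym ('a, 'n) endo = "('a, 'n) mfps ^ 'n set ^ 'n set"

definition escale :: "('a::comm_ring_1, 'n::finite) mfps \<Rightarrow> ('a, 'n) endo \<Rightarrow> ('a, 'n) endo"
    (infixr \<open>*e\<close> 75) where
  "r *e f = (\<chi> S T. r * f $ S $ T)"

text \<open>\<open>wedge i\<close> is \<open>v\<^sub>i \<and> \<bullet>\<close>, and \<open>contr i\<close> is the contraction with the dual vector of \<open>v\<^sub>i\<close>.\<close>

definition wedge :: "'n::{finite,linorder} \<Rightarrow> ('a::comm_ring_1, 'n) endo" where
  "wedge i = (\<chi> S T. if i \<notin> T \<and> S = insert i T then (-1) ^ card {j\<in>T. j < i} else 0)"

definition contr :: "'n::{finite,linorder} \<Rightarrow> ('a::comm_ring_1, 'n) endo" where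
  "contr i = (\<chi> S T. if i \<in> T \<and> S = T - {i} then (-1) ^ card {j\<in>T. j < i} else 0)"

definition ordered_prod ::
  "('n::{finite,linorder} \<Rightarrow> ('a::comm_ring_1, 'n) endo) \<Rightarrow> 'n set \<Rightarrow> ('a, 'n) endo" where
  "ordered_prod f S = foldr (\<lambda>i g. f i ** g) (sorted_list_of_set S) (mat 1)"

text \<open>
  The endomorphism of the form \<open>(\<alpha> \<and> \<bullet>) \<circ> (\<beta> \<lrcorner> \<bullet>)\<close> where \<open>\<alpha>\<close> is the wedge product of the \<open>v\<^sub>i\<close>,
  \<open>i \<in> S\<close>, and \<open>\<beta>\<close> that of the dual vectors with index in \<open>T\<close>.  The order of the factors of the
  contraction only affects the sign, which is irrelevant for the decomposition into bidegrees.
\<close>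

definition normal :: "'n::{finite,linorder} set \<Rightarrow> 'n set \<Rightarrow> ('a::comm_ring_1, 'n) endo" where
  "normal S T = ordered_prod wedge S ** ordered_prod contr T"

text \<open>
  The \<open>normal S T\<close> form a basis of the endomorphisms over the power series ring
  (see \<open>normal_coeff_ex1\<close> below); \<open>normal_coeff f S T\<close> are the coordinates of \<open>f\<close>, and the
  summand of bidegree \<open>(q, r)\<close> is spanned by the \<open>normal S T\<close> with \<open>|S| = q\<close> and \<open>|T| = r\<close>.
\<close>

definition normal_coeff ::
  "('a::comm_ring_1, 'n::{finite,linorder}) endo \<Rightarrow> 'n set \<Rightarrow> 'n set \<Rightarrow> ('a, 'n) mfps" where
  "normal_coeff f = (THE c. f = (\<Sum>S\<in>UNIV. \<Sum>T\<in>UNIV. c S T *e normal S T))"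

lemma matrix_mult_nth: "(A ** B) $ U $ W = (\<Sum>V\<in>UNIV. A $ U $ V * B $ V $ W)"
  by (simp add: matrix_matrix_mult_def)

lemma foldr_wedge_nth:
  fixes xs :: "'n::{finite,linorder} list"
  assumes "distinct xs"
  shows "\<exists>s. (\<forall>W. s W * s W = 1) \<and>
    (\<forall>U W. (foldr (\<lambda>i g. wedge i ** g) xs (mat 1) :: ('a::comm_ring_1, 'n) endo) $ U $ W =
       (if set xs \<inter> W = {} \<and> U = set xs \<union> W then s W else 0))"
  using assms
proof (induction xs)
  case Nil
  show ?case by (intro exI[of _ "\<lambda>_. 1"]) (auto simp: mat_def)
next
  case (Cons x xs)
  then obtain s where s: "\<forall>W. s W * s W = (1 :: ('a, 'n) mfps)"
    and e: "\<And>U W. (foldr (\<lambda>i g. wedge i ** g) xs (mat 1) :: ('a, 'n) endo) $ U $ W =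
       (if set xs \<inter> W = {} \<and> U = set xs \<union> W then s W else 0)" by auto
  let ?sg = "\<lambda>W. (-1) ^ card {j \<in> set xs \<union> W. j < x} :: ('a, 'n) mfps"
  have "(wedge x ** (foldr (\<lambda>i g. wedge i ** g) xs (mat 1)) :: ('a, 'n) endo) $ U $ W =
      (if set (x # xs) \<inter> W = {} \<and> U = set (x # xs) \<union> W then ?sg W * s W else 0)" for U W
  proof -
    have "(wedge x ** (foldr (\<lambda>i g. wedge i ** g) xs (mat 1)) :: ('a, 'n) endo) $ U $ W =
       (\<Sum>V\<in>UNIV. if V = set xs \<union> W then (if set xs \<inter> W = {} then wedge x $ U $ V * s W else 0) else 0)"
      unfolding matrix_mult_nth e by (rule sum.cong) auto
    also have "\<dots> = (if set xs \<inter> W = {} then wedge x $ U $ (set xs \<union> W) * s W else 0)"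
      by simp
    finally show ?thesis using Cons.prems by (auto simp: wedge_def)
  qed
  moreover have "(?sg W * s W) * (?sg W * s W) = 1" for W
  proof -
    have "(?sg W * s W) * (?sg W * s W) = (?sg W * ?sg W) * (s W * s W)" by (simp only: mult_ac)
    then show ?thesis using s by (simp flip: power_add power_mult_distrib)
  qed
  ultimately show ?case by (intro exI[of _ "\<lambda>W. ?sg W * s W"]) simp
qed

lemma foldr_contr_nth:
  fixes xs :: "'n::{finite,linorder} list"
  assumes "distinct xs"
  shows "\<exists>s. (\<forall>W. s W * s W = 1) \<and>
    (\<forall>U W. (foldr (\<lambda>i g. contr i ** g) xs (mat 1) :: ('a::comm_ring_1, 'n) endo) $ U $ W =
       (if set xs \<subseteq> W \<and> U = W - set xs then s W else 0))"
  using assms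
proof (induction xs)
  case Nil
  show ?case by (intro exI[of _ "\<lambda>_. 1"]) (auto simp: mat_def)
next
  case (Cons x xs)
  then obtain s where s: "\<forall>W. s W * s W = (1 :: ('a, 'n) mfps)"
    and e: "\<And>U W. (foldr (\<lambda>i g. contr i ** g) xs (mat 1) :: ('a, 'n) endo) $ U $ W =
       (if set xs \<subseteq> W \<and> U = W - set xs then s W else 0)" by auto
  let ?sg = "\<lambda>W. (-1) ^ card {j \<in> W - set xs. j < x} :: ('a, 'n) mfps"
  have "(contr x ** (foldr (\<lambda>i g. contr i ** g) xs (mat 1)) :: ('a, 'n) endo) $ U $ W =
      (if set (x # xs) \<subseteq> W \<and> U = W - set (x # xs) then ?sg W * s W else 0)" for U W
  proof -
    have "(contr x ** (foldr (\<lambda>i g. contr i ** g) xs (mat 1)) :: ('a, 'n) endo) $ U $ W =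
       (\<Sum>V\<in>UNIV. if V = W - set xs then (if set xs \<subseteq> W then contr x $ U $ V * s W else 0) else 0)"
      unfolding matrix_mult_nth e by (rule sum.cong) auto
    also have "\<dots> = (if set xs \<subseteq> W then contr x $ U $ (W - set xs) * s W else 0)"
      by simp
    also have "\<dots> = (if set (x # xs) \<subseteq> W \<and> U = W - set (x # xs) then ?sg W * s W else 0)"
    proof -
      have "W - set xs - {x} = W - set (x # xs)" by auto
      then show ?thesis using Cons.prems by (auto simp: contr_def)
    qed
    finally show ?thesis .
  qed
  moreover have "(?sg W * s W) * (?sg W * s W) = 1" for W
  proof -
    have "(?sg W * s W) * (?sg W * s W) = (?sg W * ?sg W) * (s W * s W)" by (simp only: mult_ac)
    then show ?thesis using s by (simp flip: power_add power_mult_distrib)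
  qed
  ultimately show ?case by (intro exI[of _ "\<lambda>W. ?sg W * s W"]) simp
qed

lemma normal_nth:
  fixes S T :: "'n::{finite,linorder} set"
  shows "\<exists>s. (\<forall>W. s W * s W = 1) \<and>
    (\<forall>U W. (normal S T :: ('a::comm_ring_1, 'n) endo) $ U $ W =
       (if T \<subseteq> W \<and> S \<inter> (W - T) = {} \<and> U = S \<union> (W - T) then s W else 0))"
proof -
  obtain s where s: "\<forall>W. s W * s W = (1 :: ('a, 'n) mfps)"
    and e: "\<And>U W. (ordered_prod wedge S :: ('a, 'n) endo) $ U $ W =
       (if S \<inter> W = {} \<and> U = S \<union> W then s W else 0)"
    using foldr_wedge_nth[of "sorted_list_of_set S", where 'a = 'a]
    by (auto simp: ordered_prod_def)
  obtain t where t: "\<forall>W. t W * t W = (1 :: ('a, 'n) mfps)"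
    and e': "\<And>U W. (ordered_prod contr T :: ('a, 'n) endo) $ U $ W =
       (if T \<subseteq> W \<and> U = W - T then t W else 0)"
    using foldr_contr_nth[of "sorted_list_of_set T", where 'a = 'a]
    by (auto simp: ordered_prod_def)
  have "(normal S T :: ('a, 'n) endo) $ U $ W =
      (if T \<subseteq> W \<and> S \<inter> (W - T) = {} \<and> U = S \<union> (W - T) then s (W - T) * t W else 0)" for U W
  proof -
    have "(normal S T :: ('a, 'n) endo) $ U $ W =
      (\<Sum>V\<in>UNIV. if V = W - T then
         (if T \<subseteq> W \<and> S \<inter> (W - T) = {} \<and> U = S \<union> (W - T) then s (W - T) * t W else 0) else 0)"
      unfolding normal_def matrix_mult_nth e e' by (rule sum.cong) auto
    then show ?thesis by simp
  qed
  moreover have "(s (W - T) * t W) * (s (W - T) * t W) = 1" for W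
  proof -
    have "(s (W - T) * t W) * (s (W - T) * t W) = (s (W - T) * s (W - T)) * (t W * t W)"
      by (simp only: mult_ac)
    then show ?thesis using s t by simp
  qed
  ultimately show ?thesis by (intro exI[of _ "\<lambda>W. s (W - T) * t W"]) simp
qed

lemma normal_coeff_ex1:
  fixes f :: "('a::comm_ring_1, 'n::{finite,linorder}) endo"
  shows "\<exists>!c. f = (\<Sum>S\<in>UNIV. \<Sum>T\<in>UNIV. c S T *e normal S T)"
proof -
  let ?N = "\<lambda>S T. normal S T :: ('a, 'n) endo"
  let ?s = "\<lambda>S T. ?N S T $ S $ T"
  let ?R = "\<lambda>c U W. \<Sum>T\<in>{T. T \<subset> W}. \<Sum>S\<in>UNIV. c T S * ?N S T $ U $ W"
  define F where "F = (\<lambda>c W U. ?s U W * (f $ U $ W - ?R c U W))"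
  have N0: "?N S T $ U $ W = 0" if "\<not> T \<subseteq> W" for S T U W
  proof -
    obtain s where s: "\<forall>W. s W * s W = (1 :: ('a, 'n) mfps)"
      and e: "\<And>U W. ?N S T $ U $ W =
        (if T \<subseteq> W \<and> S \<inter> (W - T) = {} \<and> U = S \<union> (W - T) then s W else 0)"
      using normal_nth[of S T, where 'a = 'a] by blast
    show ?thesis using that by (simp add: e)
  qed
  have N1: "?N S T $ U $ T = 0" if "U \<noteq> S" for S T U
  proof -
    obtain s where s: "\<forall>W. s W * s W = (1 :: ('a, 'n) mfps)"
      and e: "\<And>U W. ?N S T $ U $ W =
        (if T \<subseteq> W \<and> S \<inter> (W - T) = {} \<and> U = S \<union> (W - T) then s W else 0)"
      using normal_nth[of S T, where 'a = 'a] by blast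
    show ?thesis using that by (simp add: e)
  qed
  have N2: "?s S T * ?s S T = 1" for S T
  proof -
    obtain s where s: "\<forall>W. s W * s W = (1 :: ('a, 'n) mfps)"
      and e: "\<And>U W. ?N S T $ U $ W =
        (if T \<subseteq> W \<and> S \<inter> (W - T) = {} \<and> U = S \<union> (W - T) then s W else 0)"
      using normal_nth[of S T, where 'a = 'a] by blast
    show ?thesis using s by (simp add: e)
  qed
  have split: "(\<Sum>S\<in>UNIV. \<Sum>T\<in>UNIV. c T S *e ?N S T) $ U $ W = c W U * ?s U W + ?R c U W"
    for c U W
  proof -
    let ?g = "\<lambda>T. \<Sum>S\<in>UNIV. c T S * ?N S T $ U $ W"
    have "(\<Sum>S\<in>UNIV. \<Sum>T\<in>UNIV. c T S *e ?N S T) $ U $ W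
        = (\<Sum>S\<in>UNIV. \<Sum>T\<in>UNIV. c T S * ?N S T $ U $ W)"
      by (simp add: escale_def)
    also have "\<dots> = (\<Sum>T\<in>UNIV. ?g T)"
      by (rule sum.swap)
    also have "\<dots> = (\<Sum>T\<in>insert W {T. T \<subset> W}. ?g T)"
    proof (rule sum.mono_neutral_right)
      show "\<forall>T\<in>UNIV - insert W {T. T \<subset> W}. ?g T = 0"
      proof
        fix T assume "T \<in> UNIV - insert W {T. T \<subset> W}"
        then have "\<not> T \<subseteq> W" by blast
        then show "?g T = 0" by (simp add: N0)
      qed
    qed auto
    also have "\<dots> = ?g W + (\<Sum>T\<in>{T. T \<subset> W}. ?g T)"
      by (subst sum.insert) auto
    also have "?g W = (\<Sum>S\<in>UNIV. if S = U then c W U * ?s U W else 0)"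
      by (rule sum.cong) (use N1 in auto)
    finally show ?thesis by simp
  qed
  have iff: "f = (\<Sum>S\<in>UNIV. \<Sum>T\<in>UNIV. c T S *e ?N S T) \<longleftrightarrow> c = F c" for c
  proof -
    have "f = (\<Sum>S\<in>UNIV. \<Sum>T\<in>UNIV. c T S *e ?N S T) \<longleftrightarrow>
        (\<forall>W U. f $ U $ W = c W U * ?s U W + ?R c U W)"
      unfolding vec_eq_iff split by blast
    also have "\<dots> \<longleftrightarrow> (\<forall>W U. c W U = F c W U)"
    proof (intro all_cong1)
      fix W U
      have "x = y * ?s U W + r \<longleftrightarrow> y = ?s U W * (x - r)" for x y r
      proof
        assume "x = y * ?s U W + r"
        then have "?s U W * (x - r) = y * (?s U W * ?s U W)" by (simp add: mult_ac)
        then show "y = ?s U W * (x - r)" by (simp add: N2)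
      next
        assume "y = ?s U W * (x - r)"
        then have "y * ?s U W = (?s U W * ?s U W) * (x - r)" by (simp only: mult_ac)
        then show "x = y * ?s U W + r" by (simp add: N2)
      qed
      then show "f $ U $ W = c W U * ?s U W + ?R c U W \<longleftrightarrow> c W U = F c W U"
        unfolding F_def .
    qed
    also have "\<dots> \<longleftrightarrow> c = F c" by (simp add: fun_eq_iff)
    finally show ?thesis .
  qed
  have local: "F c W = F c' W" if "\<And>T. T \<subset> W \<Longrightarrow> c T = c' T" for c c' W
    using that by (simp add: F_def)
  have "adm_wf finite_psubset F"
    unfolding adm_wf_def by (intro allI impI local) (simp add: finite_psubset_def)
  then have ex: "wfrec finite_psubset F = F (wfrec finite_psubset F)"
    by (rule wfrec_fixpoint[OF wf_finite_psubset])
  have uniq: "c = c'" if c: "c = F c" and c': "c' = F c'" for c c'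
  proof
    fix W
    show "c W = c' W"
    proof (induction W rule: wf_induct_rule[OF wf_finite_psubset])
      case (1 W)
      then have "F c W = F c' W" by (intro local) (simp add: finite_psubset_def)
      then show ?case using c c' by metis
    qed
  qed
  show ?thesis
  proof (rule ex1I)
    show "f = (\<Sum>S\<in>UNIV. \<Sum>T\<in>UNIV. (\<lambda>S T. wfrec finite_psubset F T S) S T *e normal S T)"
      using iff ex by blast
    fix c assume "f = (\<Sum>S\<in>UNIV. \<Sum>T\<in>UNIV. c S T *e normal S T)"
    then have "(\<lambda>T S. c S T) = F (\<lambda>T S. c S T)" using iff[of "\<lambda>T S. c S T"] by blast
    then have "(\<lambda>T S. c S T) = wfrec finite_psubset F" using uniq ex by blast
    then show "c = (\<lambda>S T. wfrec finite_psubset F T S)" by (metis (no_types))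
  qed
qed

definition zdeg :: "int \<Rightarrow> ('a::comm_ring_1, 'n::{finite,linorder}) endo set" where
  "zdeg d = {f. \<forall>S T. normal_coeff f S T \<noteq> 0 \<longrightarrow> int (card S) - int (card T) = d}"

text \<open>The projection onto the pieces of bidegree \<open>(q, r)\<close> with \<open>q + r = k\<close>.\<close>

definition total_part :: "nat \<Rightarrow> ('a::comm_ring_1, 'n::{finite,linorder}) endo \<Rightarrow> ('a, 'n) endo" where
  "total_part k f = (\<Sum>S\<in>UNIV. \<Sum>T\<in>UNIV.
     if card S + card T = k then normal_coeff f S T *e normal S T else 0)"

text \<open>
  \<open>K s q\<close> is the direct sum over \<open>p + r = s\<close> of the degree \<open>p\<close> polynomials in bidegree \<open>(q, r)\<close>,
  and \<open>K_part s q\<close> is the projection onto it.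
\<close>

definition K :: "nat \<Rightarrow> nat \<Rightarrow> ('a::comm_ring_1, 'n::{finite,linorder}) endo set" where
  "K s q = {f. \<forall>S T m. mcoeff (normal_coeff f S T) m \<noteq> 0 \<longrightarrow> card S = q \<and> size m + card T = s}"

definition K_part ::
  "nat \<Rightarrow> nat \<Rightarrow> ('a::comm_ring_1, 'n::{finite,linorder}) endo \<Rightarrow> ('a, 'n) endo" where
  "K_part s q f = (\<Sum>S\<in>UNIV. \<Sum>T\<in>UNIV.
     Abs_mfps (\<lambda>m. if card S = q \<and> size m + card T = s then mcoeff (normal_coeff f S T) m else 0)
       *e normal S T)"

text \<open>The map \<open>f \<mapsto> f(1)\<close> modulo \<open>\<mm>\<close>, and its kernel.\<close>

definition pr :: "('a::comm_ring_1, 'n::finite) endo \<Rightarrow> ('a, 'n) ext" where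
  "pr f = (\<chi> S. mcoeff ((f *v axis {} 1) $ S) {#})"

definition ker_pr :: "('a::comm_ring_1, 'n::finite) endo set" where
  "ker_pr = {f. pr f = 0}"


section \<open>Graded commutator\<close>

text \<open>\<open>sgn_twist f\<close> is \<open>(-1)\<^bsup>|f|\<^esup> f\<close> for homogeneous \<open>f\<close>; the degree of \<open>axis S 1\<close> is \<open>|S|\<close>.\<close>

definition sgn_twist :: "('a::comm_ring_1, 'n::finite) endo \<Rightarrow> ('a, 'n) endo" where
  "sgn_twist f = (\<chi> S T. (-1) ^ (card S + card T) * f $ S $ T)"

definition even_part :: "('a::comm_ring_1, 'n::finite) endo \<Rightarrow> ('a, 'n) endo" where
  "even_part f = (\<chi> S T. if even (card S + card T) then f $ S $ T else 0)"

definition odd_part :: "('a::comm_ring_1, 'n::finite) endo \<Rightarrow> ('a, 'n) endo" where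
  "odd_part f = (\<chi> S T. if odd (card S + card T) then f $ S $ T else 0)"

definition gcomm ::
  "('a::comm_ring_1, 'n::finite) endo \<Rightarrow> ('a, 'n) endo \<Rightarrow> ('a, 'n) endo" where
  "gcomm f g = f ** g - (even_part g ** f + odd_part g ** sgn_twist f)"


section \<open>The homotopy for the leading part of the differential\<close>

definition bold_v :: "('a::comm_ring_1, 'n::{finite,linorder}) endo" where
  "bold_v = (\<Sum>i\<in>UNIV. X i *e wedge i)"

definition d1 :: "('a::comm_ring_1, 'n::{finite,linorder}) endo \<Rightarrow> ('a, 'n) endo" where
  "d1 f = gcomm f bold_v"

text \<open>
  The admissible choices of \<open>\<eta>\<^sub>-\<^sub>1\<close>.  The clause about \<open>K_part\<close> says that the map is the product
  over \<open>s \<ge> 1\<close> of the direct sums over \<open>q\<close> of its restrictions to the \<open>K s q\<close>.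
  Only the values on \<open>ker_pr\<close> matter.
\<close>

definition koszul_homotopy ::
  "(('a::comm_ring_1, 'n::{finite,linorder}) endo \<Rightarrow> ('a, 'n) endo) \<Rightarrow> bool" where
  "koszul_homotopy h \<longleftrightarrow>
     (\<forall>f\<in>ker_pr. h f \<in> ker_pr) \<and>
     (\<forall>f\<in>ker_pr. \<forall>g\<in>ker_pr. h (f + g) = h f + h g) \<and>
     (\<forall>c. \<forall>f\<in>ker_pr. h (Const c *e f) = Const c *e h f) \<and>
     (\<forall>d. \<forall>f\<in>ker_pr \<inter> zdeg d. h f \<in> zdeg (d - 1)) \<and>
     (\<forall>s\<ge>1. \<forall>q. \<forall>f\<in>K s q. h f \<in> K s q) \<and>
     (\<forall>s\<ge>1. \<forall>q. \<forall>f\<in>ker_pr. K_part s q (h f) = h (K_part s q f)) \<and>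
     (\<forall>f\<in>ker_pr. d1 (h f) + h (d1 f) = - f)"


section \<open>The matrix factorisation and its endomorphism algebra\<close>

text \<open>In this and the following sections \<open>h\<close> is \<open>\<eta>\<^sub>-\<^sub>1\<close> and \<open>w\<close> the potential.\<close>

text \<open>For \<open>r \<in> \<mm>\<close>, \<open>h (mat r)\<close> is the sum of the \<open>m_coeff h i r *e contr i\<close>.\<close>

definition m_coeff ::
  "(('a::comm_ring_1, 'n::{finite,linorder}) endo \<Rightarrow> ('a, 'n) endo) \<Rightarrow> 'n \<Rightarrow>
   ('a, 'n) mfps \<Rightarrow> ('a, 'n) mfps" where
  "m_coeff h i r = normal_coeff (h (mat r)) {} {i}"

definition w_comp ::
  "(('a::comm_ring_1, 'n::{finite,linorder}) endo \<Rightarrow> ('a, 'n) endo) \<Rightarrow> ('a, 'n) mfps \<Rightarrow>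
   'n \<Rightarrow> ('a, 'n) mfps" where
  "w_comp h w i = - m_coeff h i w"

definition lam ::
  "(('a::comm_ring_1, 'n::{finite,linorder}) endo \<Rightarrow> ('a, 'n) endo) \<Rightarrow> ('a, 'n) mfps \<Rightarrow>
   'n \<Rightarrow> 'n \<Rightarrow> ('a, 'n) mfps" where
  "lam h w i j = m_coeff h j (w_comp h w i)"

definition w_check ::
  "(('a::comm_ring_1, 'n::{finite,linorder}) endo \<Rightarrow> ('a, 'n) endo) \<Rightarrow> ('a, 'n) mfps \<Rightarrow>
   ('a, 'n) endo" where
  "w_check h w = (\<Sum>i\<in>UNIV. w_comp h w i *e contr i)"

definition d_fact ::
  "(('a::comm_ring_1, 'n::{finite,linorder}) endo \<Rightarrow> ('a, 'n) endo) \<Rightarrow> ('a, 'n) mfps \<Rightarrow>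
   ('a, 'n) endo" where
  "d_fact h w = - (bold_v + w_check h w)"

text \<open>The dg-algebra differential and product, translated by
  \<open>d a = (-1)\<^bsup>|a|\<^esup> \<mu>\<^sup>1(a)\<close> and \<open>a\<^sub>2 a\<^sub>1 = (-1)\<^bsup>|a\<^sub>1|\<^esup> \<mu>\<^sup>2(a\<^sub>2, a\<^sub>1)\<close>.\<close>

definition dg_diff ::
  "(('a::comm_ring_1, 'n::{finite,linorder}) endo \<Rightarrow> ('a, 'n) endo) \<Rightarrow> ('a, 'n) mfps \<Rightarrow>
   ('a, 'n) endo \<Rightarrow> ('a, 'n) endo" where
  "dg_diff h w f = gcomm (d_fact h w) f"

definition mu1 ::
  "(('a::comm_ring_1, 'n::{finite,linorder}) endo \<Rightarrow> ('a, 'n) endo) \<Rightarrow> ('a, 'n) mfps \<Rightarrow>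
   ('a, 'n) endo \<Rightarrow> ('a, 'n) endo" where
  "mu1 h w f = dg_diff h w (sgn_twist f)"

definition mu2 ::
  "('a::comm_ring_1, 'n::finite) endo \<Rightarrow> ('a, 'n) endo \<Rightarrow> ('a, 'n) endo" where
  "mu2 a\<^sub>2 a\<^sub>1 = a\<^sub>2 ** sgn_twist a\<^sub>1"


section \<open>The inclusion and the homotopy\<close>

definition f_gen ::
  "(('a::comm_ring_1, 'n::{finite,linorder}) endo \<Rightarrow> ('a, 'n) endo) \<Rightarrow> ('a, 'n) mfps \<Rightarrow>
   'n \<Rightarrow> ('a, 'n) endo" where
  "f_gen h w i = wedge i + (\<Sum>j\<in>UNIV. lam h w i j *e contr j)"

definition incl ::
  "(('a::comm_ring_1, 'n::{finite,linorder}) endo \<Rightarrow> ('a, 'n) endo) \<Rightarrow> ('a, 'n) mfps \<Rightarrow>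
   ('a, 'n) ext \<Rightarrow> ('a, 'n) endo" where
  "incl h w a = (\<Sum>S\<in>UNIV. Const (a $ S) *e total_part (card S) (ordered_prod (f_gen h w) S))"

definition d_minus1 ::
  "(('a::comm_ring_1, 'n::{finite,linorder}) endo \<Rightarrow> ('a, 'n) endo) \<Rightarrow> ('a, 'n) mfps \<Rightarrow>
   ('a, 'n) endo \<Rightarrow> ('a, 'n) endo" where
  "d_minus1 h w f = gcomm f (w_check h w)"

text \<open>\<open>eta_piece h w j\<close> is \<open>\<eta>\<close> with index \<open>-2j-1\<close>.\<close>

primrec eta_piece ::
  "(('a::comm_ring_1, 'n::{finite,linorder}) endo \<Rightarrow> ('a, 'n) endo) \<Rightarrow> ('a, 'n) mfps \<Rightarrow>
   nat \<Rightarrow> ('a, 'n) endo \<Rightarrow> ('a, 'n) endo" where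
  "eta_piece h w 0 f = h f"
| "eta_piece h w (Suc j) f =
     d_minus1 h w (eta_piece h w j (h f)) + eta_piece h w j (d_minus1 h w (h f))"

text \<open>On \<open>ker_pr\<close> only finitely many summands are nonzero, because the \<open>\<int>\<close>-grading is bounded.\<close>

definition eta_tilde ::
  "(('a::comm_ring_1, 'n::{finite,linorder}) endo \<Rightarrow> ('a, 'n) endo) \<Rightarrow> ('a, 'n) mfps \<Rightarrow>
   ('a, 'n) endo \<Rightarrow> ('a, 'n) endo" where
  "eta_tilde h w f = Sum_any (\<lambda>j. eta_piece h w j f)"

definition eta_ker ::
  "(('a::comm_ring_1, 'n::{finite,linorder}) endo \<Rightarrow> ('a, 'n) endo) \<Rightarrow> ('a, 'n) mfps \<Rightarrow>
   ('a, 'n) endo \<Rightarrow> ('a, 'n) endo" where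
  "eta_ker h w f = eta_tilde h w f - mu1 h w ((eta_tilde h w ^^ 3) (mu1 h w f))"

text \<open>
  The extension of \<open>eta_ker\<close> by \<open>0\<close> on the image of \<open>incl\<close>: the projection onto \<open>ker_pr\<close> along
  that image is \<open>f \<mapsto> f - incl (pr f)\<close>.
\<close>

definition eta ::
  "(('a::comm_ring_1, 'n::{finite,linorder}) endo \<Rightarrow> ('a, 'n) endo) \<Rightarrow> ('a, 'n) mfps \<Rightarrow>
   ('a, 'n) endo \<Rightarrow> ('a, 'n) endo" where
  "eta h w f = eta_ker h w (f - incl h w (pr f))"


section \<open>The minimal model and its disc potential\<close>

text \<open>
  Arguments of \<open>A\<^sub>\<infinity>\<close>-operations are lists in the written order \<open>[a\<^sub>k, \<dots>, a\<^sub>1]\<close>.  The conditionals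
  implement the convention that \<open>\<eta> \<circ> p\<^sub>1\<close> is the identity.
\<close>

function p_op ::
  "(('a::comm_ring_1, 'n::finite) endo \<Rightarrow> ('a, 'n) endo) \<Rightarrow> ('a, 'n) endo list \<Rightarrow> ('a, 'n) endo" where
  "p_op \<eta> as = (\<Sum>j\<in>{1..<length as}.
     mu2 (if length as - j = 1 then hd as else \<eta> (p_op \<eta> (take (length as - j) as)))
         (if j = 1 then last as else \<eta> (p_op \<eta> (drop (length as - j) as))))"
  by pat_completeness auto
termination
  by (relation "measure (\<lambda>(\<eta>, as). length as)") auto

declare p_op.simps [simp del]

text \<open>The operations \<open>\<mu>\<^sup>k\<close>, \<open>k \<ge> 2\<close>, of the minimal model, \<open>k\<close> being the length of the list.\<close>

definition mu_min ::
  "(('a::comm_ring_1, 'n::{finite,linorder}) endo \<Rightarrow> ('a, 'n) endo) \<Rightarrow> ('a, 'n) mfps \<Rightarrow>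
   ('a, 'n) ext list \<Rightarrow> ('a, 'n) ext" where
  "mu_min h w as = pr (p_op (eta h w) (map (incl h w) as))"

text \<open>
  The part of the disc potential that is homogeneous of degree \<open>k\<close>: the sum over the sequences
  \<open>i\<^sub>1, \<dots>, i\<^sub>k\<close> of \<open>\<mu>\<^sup>k(v\<^sub>i\<^sub>k, \<dots>, v\<^sub>i\<^sub>1) x\<^sub>i\<^sub>1 \<dots> x\<^sub>i\<^sub>k\<close>, a priori with values in the whole exterior
  algebra over the power series ring.
\<close>

definition disc_part ::
  "(('a::comm_ring_1, 'n::{finite,linorder}) endo \<Rightarrow> ('a, 'n) endo) \<Rightarrow> ('a, 'n) mfps \<Rightarrow>
   nat \<Rightarrow> ('a, 'n) extR" where
  "disc_part h w k = (\<chi> S. \<Sum>is | length is = k.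
     Const (mu_min h w (map (\<lambda>i. axis {i} 1) (rev is)) $ S) * prod_list (map X is))"

text \<open>The formal sum over \<open>k \<ge> 2\<close>; the terms with \<open>k > size m\<close> do not contribute to the
  coefficient of \<open>m\<close>.\<close>

definition disc_potential ::
  "(('a::comm_ring_1, 'n::{finite,linorder}) endo \<Rightarrow> ('a, 'n) endo) \<Rightarrow> ('a, 'n) mfps \<Rightarrow>
   ('a, 'n) extR" where
  "disc_potential h w = (\<chi> S. Abs_mfps (\<lambda>m. \<Sum>k\<in>{2..size m}. mcoeff (disc_part h w k $ S) m))"

end

theory Submission
  imports Defs
begin

text \<open>
  Write \<open>D\<^sub>i r = - m\<^sub>i (r - r(0))\<close>, so that \<open>r = r(0) + \<Sum>\<^sub>i x\<^sub>i D\<^sub>i r\<close>.  Take a second set of variables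
  \<open>y\<^sub>i\<close> and sum the tree formulas \<open>p\<^sub>k\<close> over all words in \<open>b = \<Sum>\<^sub>i y\<^sub>i f\<^sub>i\<close>.  By induction on \<open>k\<close> the sum
  \<open>p\<^sub>k(b, \<dots>, b)\<close> is the scalar \<open>(\<Sum>\<^sub>i y\<^sub>i D\<^sub>i)\<^sup>k w\<close>: on a scalar \<open>r\<close> the homotopy \<open>\<eta>\<close> reduces to
  \<open>- \<Sum>\<^sub>i D\<^sub>i r v\<^sub>i\<^sup>\<or>\<close>, because \<open>d\<^sub>-\<^sub>1\<close> kills everything of exterior degree \<open>q = 0\<close>, and the sum over
  \<open>j\<close> of the products of \<open>\<eta> p\<^sub>k\<^sub>-\<^sub>j\<close> and \<open>\<eta> p\<^sub>j\<close> is symmetric, hence scalar by the Clifford relations.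
  Setting \<open>x = 0\<close> and iterating \<open>r = r(0) + \<Sum>\<^sub>i x\<^sub>i D\<^sub>i r\<close> identifies the sum over \<open>k\<close> with \<open>w(y)\<close>.
  The coefficient of a monomial in \<open>y\<close> is the sum over the words with that content, so the
  variables \<open>y\<^sub>i\<close> themselves are not needed.
\<close>

section \<open>Power series\<close>

lemma mcoeff_simps [simp]:
  "mcoeff 0 m = 0"
  "mcoeff (f + g) m = mcoeff f m + mcoeff g m"
  "mcoeff (f - g) m = mcoeff f m - mcoeff g m"
  "mcoeff (- f) m = - mcoeff f m"
  "mcoeff 1 m = (if m = {#} then 1 else 0)"
  "mcoeff (Const c) m = (if m = {#} then c else 0)"
  "mcoeff (X i) m = (if m = {#i#} then 1 else 0)"
  by (simp_all add: zero_mfps_def one_mfps_def plus_mfps_def minus_mfps_def uminus_mfps_def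
      Const_def X_def)

lemma mcoeff_sum [simp]: "mcoeff (sum f A) m = (\<Sum>x\<in>A. mcoeff (f x) m)"
  by (induction A rule: infinite_finite_induct) auto

lemma mcoeff_times: "mcoeff (f * g) m = (\<Sum>(a, b) | a + b = m. mcoeff f a * mcoeff g b)"
  by (simp add: times_mfps_def)

lemma mcoeff_times_0 [simp]: "mcoeff (f * g) {#} = mcoeff f {#} * mcoeff g {#}"
proof -
  have "{(a, b). a + b = ({#} :: 'b multiset)} = {({#}, {#})}" by auto
  then show ?thesis by (simp add: mcoeff_times)
qed

lemma mcoeff_Const_times [simp]: "mcoeff (Const c * f) m = c * mcoeff f m"
proof -
  have "mcoeff (Const c * f) m = (\<Sum>p | fst p + snd p = m. if p = ({#}, m) then c * mcoeff f m else 0)"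
    unfolding mcoeff_times by (rule sum.cong) (auto split: if_splits)
  also have "\<dots> = c * mcoeff f m"
    using finite_mset_splits[of m] by (subst sum.delta) (simp_all add: case_prod_beta')
  finally show ?thesis .
qed

lemma mcoeff_X_times: "mcoeff (X i * f) m = (if i \<in># m then mcoeff f (m - {#i#}) else 0)"
proof -
  have "mcoeff (X i * f) m = (\<Sum>p | fst p + snd p = m.
      if p = ({#i#}, m - {#i#}) then mcoeff f (m - {#i#}) else 0)"
    unfolding mcoeff_times by (rule sum.cong) (auto split: if_splits)
  also have "\<dots> = (if i \<in># m then mcoeff f (m - {#i#}) else 0)"
    using finite_mset_splits[of m]
    by (subst sum.delta) (auto simp add: case_prod_beta' dest: union_single_eq_member)
  finally show ?thesis .
qed

lemma Const_0 [simp]: "Const 0 = 0" and Const_1 [simp]: "Const 1 = 1"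
  and Const_add: "Const (a + b) = Const a + Const b"
  by (simp_all add: mfps_eq_iff)

lemma mcoeff_prod_list_X:
  "mcoeff (prod_list (map X is)) m = (if mset is = m then 1 else 0)"
  by (induction "is" arbitrary: m) (auto simp: mcoeff_X_times)

text \<open>The form in which the hypothesis on the potential enters: no constant and no linear
  term.\<close>

lemma max_ideal_sq_mcoeff:
  assumes "w \<in> max_ideal_sq" "size m < 2"
  shows "mcoeff w m = 0"
proof -
  obtain g where w: "w = (\<Sum>i\<in>UNIV. \<Sum>j\<in>UNIV. X i * X j * g i j)"
    using assms(1) by (auto simp: max_ideal_sq_def)
  have "mcoeff (X i * X j * g i j) m = 0" for i j
    using assms(2) by (auto simp: mult.assoc mcoeff_X_times size_Diff_singleton
        dest!: multi_member_split)
  then show ?thesis by (simp add: w)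
qed


section \<open>Matrices over power series\<close>

lemma escale_nth [simp]: "(r *e f) $ U $ W = r * f $ U $ W"
  by (simp add: escale_def)

lemma escale_simps [simp]:
  "0 *e f = 0" "1 *e f = f" "r *e 0 = 0" "(- r) *e f = - (r *e f)" "r *e (- f) = - (r *e f)"
  "r *e s *e f = (r * s) *e f"
  by (simp_all add: vec_eq_iff mult.assoc)

lemma if_escale: "(if b then 1 else 0) *e f = (if b then f else 0)"
  by simp

lemma escale_add: "r *e (f + g) = r *e f + r *e g" "(r + s) *e f = r *e f + s *e f"
  by (simp_all add: vec_eq_iff algebra_simps)

lemma escale_diff: "r *e (f - g) = r *e f - r *e g"
  by (simp add: vec_eq_iff algebra_simps)

lemma escale_sum: "r *e sum f A = (\<Sum>x\<in>A. r *e f x)"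
  by (induction A rule: infinite_finite_induct) (auto simp: escale_add)

lemma mat_escale: "mat r = r *e mat 1"
  by (simp add: vec_eq_iff mat_def)

lemma mat_nth: "mat r $ U $ W = (if U = W then r else 0)"
  by (simp add: mat_def)

lemma mat_minus: "mat (- r) = - (mat r :: ('a::comm_ring_1, 'n::finite) endo)"
  by (simp add: vec_eq_iff mat_def)

lemma mat_diff: "mat (r - s) = mat r - (mat s :: ('a::comm_ring_1, 'n::finite) endo)"
  by (simp add: vec_eq_iff mat_def)

lemma mat_sum: "mat (sum r A) = (\<Sum>x\<in>A. mat (r x) :: ('a::comm_ring_1, 'n::finite) endo)"
  by (induction A rule: infinite_finite_induct) (auto simp: vec_eq_iff mat_def)

lemma mult_simps [simp]:
  fixes f g :: "('a::comm_ring_1, 'n::finite) endo"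
  shows "f ** 0 = 0" "0 ** f = 0" "f ** mat 1 = f" "mat 1 ** f = f"
    "f ** mat r = r *e f" "mat r ** f = r *e f"
    "(- f) ** g = - (f ** g)" "f ** (- g) = - (f ** g)"
    "(r *e f) ** g = r *e (f ** g)" "f ** (r *e g) = r *e (f ** g)"
  by (simp_all add: vec_eq_iff matrix_mult_nth mat_nth sum_negf sum_distrib_left mult_ac
      if_distrib[of "\<lambda>x. x * _"] if_distrib[of "\<lambda>x. _ * x"] cong: if_cong)

lemma mult_distribs:
  fixes f g k :: "('a::comm_ring_1, 'n::finite) endo"
  shows "(f + g) ** k = f ** k + g ** k" "k ** (f + g) = k ** f + k ** g"
    "(f - g) ** k = f ** k - g ** k" "k ** (f - g) = k ** f - k ** g"
  by (simp_all add: vec_eq_iff matrix_mult_nth algebra_simps sum.distrib sum_subtractf)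

lemma mult_assoc:
  fixes f g k :: "('a::comm_ring_1, 'n::finite) endo"
  shows "(f ** g) ** k = f ** (g ** k)"
  by (rule matrix_mul_assoc[symmetric])

lemma mult_sum_left:
  fixes f :: "'b \<Rightarrow> ('a::comm_ring_1, 'n::finite) endo" and g :: "('a, 'n) endo"
  shows "sum f A ** g = (\<Sum>x\<in>A. f x ** g)"
  by (induction A rule: infinite_finite_induct) (auto simp: mult_distribs)

lemma mult_sum_right:
  fixes f :: "'b \<Rightarrow> ('a::comm_ring_1, 'n::finite) endo" and g :: "('a, 'n) endo"
  shows "g ** sum f A = (\<Sum>x\<in>A. g ** f x)"
  by (induction A rule: infinite_finite_induct) (auto simp: mult_distribs)

lemma sgn_twist_simps [simp]:
  "sgn_twist 0 = 0" "sgn_twist (f + g) = sgn_twist f + sgn_twist g"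
  "sgn_twist (- f) = - sgn_twist f" "sgn_twist (f - g) = sgn_twist f - sgn_twist g"
  "sgn_twist (r *e f) = r *e sgn_twist f" "sgn_twist (mat r) = mat r"
  by (auto simp: vec_eq_iff sgn_twist_def algebra_simps mat_nth)

lemma sgn_twist_sum: "sgn_twist (sum f A) = (\<Sum>x\<in>A. sgn_twist (f x))"
  by (induction A rule: infinite_finite_induct) auto

lemma sgn_twist_mult: "sgn_twist (f ** g) = sgn_twist f ** sgn_twist g"
proof -
  have "(-1) ^ (card U + card W) * (f $ U $ V * g $ V $ W) =
      (-1) ^ (card U + card V) * f $ U $ V * ((-1) ^ (card V + card W) * g $ V $ W)" for U V W
  proof -
    have "(-1 :: ('a, 'b) mfps) ^ (card U + card W) =
        (-1) ^ (card U + card V) * (-1) ^ (card V + card W)"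
      by (simp add: minus_one_power_iff)
    then show ?thesis by (simp only: mult_ac)
  qed
  then show ?thesis
    by (simp add: vec_eq_iff sgn_twist_def matrix_mult_nth sum_distrib_left)
qed

text \<open>Antisymmetry alone shows only that twice the sum is zero, and 2 may be a zero divisor in
  the base ring. The vanishing diagonal together with induction on \<open>A\<close> avoids
  halving.\<close>

lemma sum_alternating:
  fixes F :: "'i \<Rightarrow> 'i \<Rightarrow> 'b::ab_group_add"
  assumes "finite A" "\<And>i j. i \<in> A \<Longrightarrow> j \<in> A \<Longrightarrow> F i j = - F j i" "\<And>i. i \<in> A \<Longrightarrow> F i i = 0"
  shows "(\<Sum>i\<in>A. \<Sum>j\<in>A. F i j) = 0"
  using assms
proof (induction A rule: finite_induct)
  case (insert x A)
  have "(\<Sum>i\<in>A. F i x) = (\<Sum>i\<in>A. - F x i)"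
    by (rule sum.cong[OF refl], rule insert.prems(1)) auto
  moreover have "(\<Sum>i\<in>A. \<Sum>j\<in>A. F i j) = 0"
  proof (rule insert.IH)
    show "F i j = - F j i" if "i \<in> A" "j \<in> A" for i j
      by (rule insert.prems(1)) (use that in auto)
    show "F i i = 0" if "i \<in> A" for i
      by (rule insert.prems(2)) (use that in auto)
  qed
  ultimately show ?case
    using insert.hyps insert.prems(2)[of x] by (simp add: sum.distrib sum_negf)
qed simp


section \<open>Clifford relations\<close>

text \<open>The sign shared by \<open>wedge\<close> and \<open>contr\<close>. Only elements below
  \<open>i\<close> count, so it is the same with or without \<open>i\<close> in
  \<open>U\<close>.\<close>

definition lsign :: "'n::{finite,linorder} set \<Rightarrow> 'n \<Rightarrow> ('a::comm_ring_1, 'n) mfps" where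
  "lsign U i = (-1) ^ card {j\<in>U. j < i}"

lemma lsign_self [simp]:
  "lsign (insert i U) i = lsign U i" "lsign (U - {i}) i = lsign U i"
proof -
  have "{j \<in> insert i U. j < i} = {j\<in>U. j < i}" "{j \<in> U - {i}. j < i} = {j\<in>U. j < i}" by auto
  then show "lsign (insert i U) i = lsign U i" "lsign (U - {i}) i = lsign U i"
    by (simp_all add: lsign_def)
qed

lemma lsign_square [simp]:
  fixes r :: "('a::comm_ring_1, 'n::{finite,linorder}) mfps"
  shows "lsign U i * lsign U i = (1 :: ('a, 'n) mfps)" "lsign U i * (lsign U i * r) = r"
proof -
  show "lsign U i * lsign U i = (1 :: ('a, 'n) mfps)"
    by (simp add: lsign_def flip: power_mult_distrib)
  then show "lsign U i * (lsign U i * r) = r"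
    by (simp flip: mult.assoc)
qed

lemma lsign_insert:
  "j \<notin> U \<Longrightarrow> lsign (insert j U) i = (if j < i then - lsign U i else lsign U i)"
proof -
  assume "j \<notin> U"
  moreover have "{k \<in> insert j U. k < i} = (if j < i then insert j {k\<in>U. k < i} else {k\<in>U. k < i})"
    by auto
  ultimately show ?thesis by (simp add: lsign_def)
qed

lemma lsign_remove:
  assumes "j \<in> U" shows "lsign (U - {j}) i = (if j < i then - lsign U i else lsign U i)"
  using mk_disjoint_insert[OF assms] by (auto simp: lsign_insert)

text \<open>Solved for the column index: row \<open>U\<close> has at most one nonzero entry, so
  multiplying by \<open>wedge i\<close> from the left picks out one row of the other factor.
  \<open>contr_nth\<close> does the same for contractions.\<close>

lemma wedge_nth: "wedge i $ U $ V = (if i \<in> U \<and> V = U - {i} then lsign U i else 0)"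
proof -
  have "wedge i $ U $ V = (if i \<notin> V \<and> U = insert i V then lsign V i else 0)"
    by (simp add: wedge_def lsign_def)
  also have "\<dots> = (if i \<in> U \<and> V = U - {i} then lsign U i else 0)"
    by (rule if_cong) auto
  finally show ?thesis .
qed

lemma contr_nth: "contr i $ U $ V = (if i \<notin> U \<and> V = insert i U then lsign U i else 0)"
proof -
  have "contr i $ U $ V = (if i \<in> V \<and> U = V - {i} then lsign V i else 0)"
    by (simp add: contr_def lsign_def)
  also have "\<dots> = (if i \<notin> U \<and> V = insert i U then lsign U i else 0)"
    by (rule if_cong) auto
  finally show ?thesis .
qed

lemma wedge_mult_nth:
  "(wedge i ** f) $ U $ W = (if i \<in> U then lsign U i * f $ (U - {i}) $ W else 0)"
proof -
  have "(wedge i ** f) $ U $ W =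
      (\<Sum>V\<in>UNIV. if V = U - {i} then (if i \<in> U then lsign U i * f $ (U - {i}) $ W else 0) else 0)"
    unfolding matrix_mult_nth wedge_nth by (rule sum.cong) auto
  then show ?thesis by simp
qed

lemma contr_mult_nth:
  "(contr i ** f) $ U $ W = (if i \<notin> U then lsign U i * f $ (insert i U) $ W else 0)"
proof -
  have "(contr i ** f) $ U $ W =
      (\<Sum>V\<in>UNIV. if V = insert i U then (if i \<notin> U then lsign U i * f $ (insert i U) $ W else 0) else 0)"
    unfolding matrix_mult_nth contr_nth by (rule sum.cong) auto
  then show ?thesis by simp
qed

lemma clifford:
  fixes i j :: "'n::{finite,linorder}"
  defines "W \<equiv> wedge :: 'n \<Rightarrow> ('a::comm_ring_1, 'n) endo" and "C \<equiv> contr"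
  shows "W i ** W i = 0" "C i ** C i = 0" "W i ** W j = - (W j ** W i)" "C i ** C j = - (C j ** C i)"
    "W i ** C i + C i ** W i = mat 1" "i \<noteq> j \<Longrightarrow> W i ** C j = - (C j ** W i)"
proof -
  \<comment> \<open>Testing the relations against an arbitrary \<open>f\<close> lets
    \<open>wedge_mult_nth\<close> and \<open>contr_mult_nth\<close> evaluate both factors without a
    sum. Comparing \<open>i\<close> with \<open>j\<close> decides the signs, and
    \<open>f = mat 1\<close> gives the relations themselves.\<close>
  have 1: "W i ** (W i ** f) = 0" "C i ** (C i ** f) = 0" "W i ** (W j ** f) = - (W j ** (W i ** f))"
    "C i ** (C j ** f) = - (C j ** (C i ** f))" "W i ** (C i ** f) + C i ** (W i ** f) = f"
    "i \<noteq> j \<Longrightarrow> W i ** (C j ** f) = - (C j ** (W i ** f))" for f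
    unfolding W_def C_def
    by (cases i j rule: linorder_cases;
        auto simp: vec_eq_iff wedge_mult_nth contr_mult_nth lsign_insert lsign_remove
          insert_absorb insert_commute insert_Diff_if Diff_insert2[symmetric] mult_ac)+
  show "W i ** W i = 0" "C i ** C i = 0" "W i ** W j = - (W j ** W i)" "C i ** C j = - (C j ** C i)"
    "W i ** C i + C i ** W i = mat 1" "i \<noteq> j \<Longrightarrow> W i ** C j = - (C j ** W i)"
    using 1[of "mat 1"] by simp_all
qed


text \<open>An element of the sum of \<open>V\<close> and its dual with power series coefficients.
  \<open>bold_v\<close>, \<open>w_check\<close> and every \<open>f_gen\<close> have this form, so
  one Clifford calculus covers the differentials and the generators.\<close>

definition cliff :: "('n::{finite,linorder} \<Rightarrow> ('a::comm_ring_1, 'n) mfps) \<Rightarrow>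
    ('n \<Rightarrow> ('a, 'n) mfps) \<Rightarrow> ('a, 'n) endo" where
  "cliff a g = (\<Sum>i\<in>UNIV. a i *e wedge i + g i *e contr i)"

lemma odd_card_insert:
  fixes i :: "'n::finite"
  shows "i \<notin> U \<Longrightarrow> odd (card U + card (insert i U))"
  by auto

lemma odd_cliff: "even (card U + card V) \<Longrightarrow> cliff a g $ U $ V = 0"
  by (auto simp: cliff_def wedge_nth contr_nth odd_card_insert intro!: sum.neutral)

lemma sgn_twist_odd:
  assumes "\<And>U V. even (card U + card V) \<Longrightarrow> f $ U $ V = 0"
  shows "sgn_twist f = - f" "even_part f = 0" "odd_part f = f"
  using assms by (auto simp: vec_eq_iff sgn_twist_def even_part_def odd_part_def minus_one_power_iff)

lemma sgn_twist_cliff [simp]: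
  "sgn_twist (cliff a g) = - cliff a g" "even_part (cliff a g) = 0" "odd_part (cliff a g) = cliff a g"
  by (rule sgn_twist_odd, rule odd_cliff, assumption)+

lemma gcomm_cliff: "gcomm f (cliff a g) = f ** cliff a g - cliff a g ** sgn_twist f"
  by (simp add: gcomm_def)

lemma sgn_twist_gen [simp]: "sgn_twist (wedge i) = - wedge i" "sgn_twist (contr i) = - contr i"
  by (rule sgn_twist_odd, auto simp: wedge_nth contr_nth odd_card_insert)+

lemma cliff_const_0:
  assumes "\<And>i. mcoeff (a i) {#} = 0" "\<And>i. mcoeff (g i) {#} = 0"
  shows "mcoeff (cliff a g $ U $ V) {#} = 0"
  using assms by (simp add: cliff_def)

text \<open>The quadratic form of the Clifford algebra is the pairing of the two components.
  Expanding gives a double sum that becomes alternating once the diagonal terms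
  \<open>a i * g i\<close> are subtracted.\<close>

lemma cliff_square:
  fixes a g :: "'n::{finite,linorder} \<Rightarrow> ('a::comm_ring_1, 'n) mfps"
  shows "cliff a g ** cliff a g = mat (\<Sum>i\<in>UNIV. a i * g i)"
proof -
  let ?e = "\<lambda>i. a i *e wedge i + g i *e contr i"
  let ?d = "\<lambda>i j. mat (if i = j then a i * g i else 0)"
  let ?F = "\<lambda>i j. ?e i ** ?e j - ?d i j"
  have diag: "?F i i = 0" for i
  proof -
    have "mat (a i * g i) = (a i * g i) *e (wedge i ** contr i + contr i ** wedge i)"
      by (subst clifford(5)) (rule mat_escale)
    then show ?thesis
      by (simp add: mult_distribs escale_add clifford(1,2) mult.commute)
  qed
  have anti: "?F i j = - ?F j i" for i j
  proof (cases "i = j")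
    case True then show ?thesis using diag by simp
  next
    case False
    then show ?thesis
      using clifford(3)[of i j, where 'a = 'a] clifford(4)[of i j, where 'a = 'a]
        clifford(6)[of i j, where 'a = 'a] clifford(6)[of j i, where 'a = 'a]
      by (simp add: mult_distribs escale_add escale_diff mult.commute)
  qed
  have "(\<Sum>i\<in>UNIV. \<Sum>j\<in>UNIV. ?F i j) = 0"
    by (rule sum_alternating) (simp, rule anti, rule diag)
  moreover have "cliff a g ** cliff a g = (\<Sum>i\<in>UNIV. \<Sum>j\<in>UNIV. ?e i ** ?e j)"
    by (simp only: cliff_def mult_sum_left mult_sum_right) (rule sum.swap)
  moreover have "(\<Sum>i\<in>UNIV. \<Sum>j\<in>UNIV. ?d i j) = (mat (\<Sum>i\<in>UNIV. a i * g i) :: ('a, 'n) endo)"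
    by (simp flip: mat_sum)
  ultimately show ?thesis by (simp add: sum_subtractf)
qed

lemma cliff_add: "cliff a g + cliff b k = cliff (\<lambda>i. a i + b i) (\<lambda>i. g i + k i)"
  by (simp add: cliff_def sum.distrib[symmetric] escale_add algebra_simps)

text \<open>Polarisation of \<open>cliff_square\<close>.\<close>

lemma cliff_anticommute:
  "cliff a g ** cliff b k + cliff b k ** cliff a g = mat (\<Sum>i\<in>UNIV. a i * k i + b i * g i)"
proof -
  have "(cliff a g + cliff b k) ** (cliff a g + cliff b k) =
      mat (\<Sum>i\<in>UNIV. a i * g i) + mat (\<Sum>i\<in>UNIV. b i * k i) + mat (\<Sum>i\<in>UNIV. a i * k i + b i * g i)"
    by (simp add: cliff_add cliff_square)
       (simp add: vec_eq_iff mat_def algebra_simps sum.distrib)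
  then show ?thesis by (simp add: mult_distribs cliff_square algebra_simps)
qed

text \<open>The pairs \<open>(a, b)\<close> and \<open>(b, a)\<close> together give an
  anticommutator and a pair \<open>(a, a)\<close> gives a square, so the whole sum is scalar. As
  both orders occur, pairing only \<open>\<alpha> a\<close> with \<open>\<beta> b\<close> accounts
  for each anticommutator without halving.\<close>

lemma sum_cliff_products:
  fixes m :: "'k multiset" and \<alpha> \<beta> :: "'k multiset \<Rightarrow> 'n::{finite,linorder} \<Rightarrow> ('a::comm_ring_1, 'n) mfps"
  assumes "\<And>a b. a + b = m \<Longrightarrow> P a b \<Longrightarrow> P b a"
  shows "(\<Sum>(a, b) | a + b = m \<and> P a b. cliff (\<alpha> a) (\<beta> a) ** cliff (\<alpha> b) (\<beta> b)) =
    mat (\<Sum>(a, b) | a + b = m \<and> P a b. \<Sum>i\<in>UNIV. \<alpha> a i * \<beta> b i)"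
proof -
  let ?A = "{a. a \<subseteq># m}" and ?S = "{(a, b). a + b = m \<and> P a b}"
  let ?q = "\<lambda>a b. \<Sum>i\<in>UNIV. \<alpha> a i * \<beta> b i"
  let ?c = "\<lambda>a. cliff (\<alpha> a) (\<beta> a)"
  \<comment> \<open>Moving the condition into the summand turns the range into a full square, as
    \<open>sum_alternating\<close> requires.\<close>
  let ?F = "\<lambda>a b. if a + b = m \<and> P a b then ?c a ** ?c b - mat (?q a b) else 0"
  have "?c a ** ?c b - mat (?q a b) = - (?c b ** ?c a - mat (?q b a))" for a b
  proof -
    have "?c a ** ?c b + ?c b ** ?c a = mat (?q a b) + mat (?q b a)"
      by (subst cliff_anticommute) (simp add: vec_eq_iff mat_def sum.distrib)
    then show ?thesis by (simp add: algebra_simps)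
  qed
  then have anti: "?F a b = - ?F b a" for a b
    using assms[of a b] assms[of b a] by (auto simp: add.commute)
  have "0 = (\<Sum>a\<in>?A. \<Sum>b\<in>?A. ?F a b)"
    by (rule sum_alternating[symmetric]) (simp add: finite_submultisets, rule anti, simp add: cliff_square)
  also have "\<dots> = (\<Sum>(a, b)\<in>?A \<times> ?A. ?F a b)"
    by (simp add: sum.cartesian_product)
  also have "\<dots> = (\<Sum>(a, b)\<in>?S. ?F a b)"
    by (rule sum.mono_neutral_right) (auto simp: finite_submultisets split: if_splits)
  also have "\<dots> = (\<Sum>(a, b)\<in>?S. ?c a ** ?c b) - (\<Sum>(a, b)\<in>?S. mat (?q a b))"
    by (simp add: case_prod_beta' sum_subtractf[symmetric])
  also have "(\<Sum>(a, b)\<in>?S. mat (?q a b)) =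
      (mat (\<Sum>(a, b)\<in>?S. ?q a b) :: ('a, 'n) endo)"
    by (simp add: case_prod_beta' mat_sum)
  finally show ?thesis by (simp add: case_prod_beta')
qed


section \<open>Coordinates with respect to bidegrees\<close>

lemma normal_expansion: "f = (\<Sum>S\<in>UNIV. \<Sum>T\<in>UNIV. normal_coeff f S T *e normal S T)"
  unfolding normal_coeff_def by (rule theI'[OF normal_coeff_ex1])

lemma normal_coeff_combination:
  "normal_coeff (\<Sum>S\<in>UNIV. \<Sum>T\<in>UNIV. c S T *e normal S T) = c"
  unfolding normal_coeff_def by (rule the1_equality[OF normal_coeff_ex1]) simp

lemma normal_coeffI:
  "f = (\<Sum>S\<in>UNIV. \<Sum>T\<in>UNIV. c S T *e normal S T) \<Longrightarrow> normal_coeff f S T = c S T"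
  by (simp add: normal_coeff_combination)

lemma normal_coeff_inject:
  assumes "\<And>S T. normal_coeff f S T = normal_coeff g S T"
  shows "f = g"
proof -
  have "f = (\<Sum>S\<in>UNIV. \<Sum>T\<in>UNIV. normal_coeff f S T *e normal S T)" by (rule normal_expansion)
  also have "\<dots> = (\<Sum>S\<in>UNIV. \<Sum>T\<in>UNIV. normal_coeff g S T *e normal S T)" by (simp only: assms)
  also have "\<dots> = g" by (rule normal_expansion[symmetric])
  finally show ?thesis .
qed

lemma normal_coeff_add [simp]: "normal_coeff (f + g) S T = normal_coeff f S T + normal_coeff g S T"
proof (rule normal_coeffI)
  show "f + g = (\<Sum>S\<in>UNIV. \<Sum>T\<in>UNIV. (normal_coeff f S T + normal_coeff g S T) *e normal S T)"
    by (subst normal_expansion[of f], subst normal_expansion[of g])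
       (simp add: escale_add sum.distrib)
qed

lemma normal_coeff_escale [simp]: "normal_coeff (r *e f) S T = r * normal_coeff f S T"
proof (rule normal_coeffI)
  show "r *e f = (\<Sum>S\<in>UNIV. \<Sum>T\<in>UNIV. (r * normal_coeff f S T) *e normal S T)"
    by (subst normal_expansion[of f]) (simp add: escale_sum)
qed

lemma normal_coeff_0 [simp]: "normal_coeff 0 S T = 0"
  using normal_coeff_add[of 0 0 S T] by simp

lemma normal_coeff_sum [simp]: "normal_coeff (sum f A) S T = (\<Sum>x\<in>A. normal_coeff (f x) S T)"
  by (induction A rule: infinite_finite_induct) auto

lemma normal_coeff_normal [simp]:
  "normal_coeff (normal S' T') S T = (if S = S' \<and> T = T' then 1 else 0)"
proof (rule normal_coeffI)
  let ?c = "\<lambda>S T. if S = S' \<and> T = T' then 1 else 0 :: ('a, 'b) mfps"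
  have "(\<Sum>S\<in>UNIV. \<Sum>T\<in>UNIV. ?c S T *e normal S T) =
      (\<Sum>S\<in>UNIV. if S = S' then (\<Sum>T\<in>UNIV. if T = T' then normal S T else 0) else 0)"
    by (intro sum.cong refl) (auto simp: if_escale)
  then show "normal S' T' = (\<Sum>S\<in>UNIV. \<Sum>T\<in>UNIV. ?c S T *e normal S T)"
    by simp
qed

lemma normal_special:
  "normal {} {} = mat 1" "normal {i} {} = wedge i" "normal {} {i} = contr i"
  by (simp_all add: normal_def ordered_prod_def)

lemma normal_coeff_mat [simp]: "normal_coeff (mat r) S T = (if S = {} \<and> T = {} then r else 0)"
  by (subst mat_escale, subst normal_special(1)[symmetric]) simp

lemma normal_coeff_cliff:
  "normal_coeff (cliff a g) S T =
    (\<Sum>i\<in>UNIV. (if S = {i} \<and> T = {} then a i else 0) + (if S = {} \<and> T = {i} then g i else 0))"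
  unfolding cliff_def normal_special[symmetric] by (auto intro!: sum.cong)

lemma normal_coeff_total_part [simp]:
  "normal_coeff (total_part k f) S T = (if card S + card T = k then normal_coeff f S T else 0)"
  by (rule normal_coeffI) (auto simp: total_part_def intro!: sum.cong)

lemma normal_coeff_K_part [simp]:
  "normal_coeff (K_part s q f) S T =
    Abs_mfps (\<lambda>m. if card S = q \<and> size m + card T = s then mcoeff (normal_coeff f S T) m else 0)"
  by (rule normal_coeffI) (simp add: K_part_def)

text \<open>In a sorted list each new factor precedes all indices already present, so no sign
  appears: the product sends 1 to the basis vector itself.\<close>

lemma foldr_wedge_empty:
  fixes xs :: "'n::{finite,linorder} list"
  assumes "sorted xs" "distinct xs"
  shows "(foldr (\<lambda>i g. wedge i ** g) xs (mat 1) :: ('a::comm_ring_1, 'n) endo) $ U $ {} =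
    (if U = set xs then 1 else 0)"
  using assms
proof (induction xs arbitrary: U)
  case (Cons x xs)
  have "lsign (insert x (set xs)) x = (1 :: ('a, 'n) mfps)"
  proof -
    have e: "{j \<in> insert x (set xs). j < x} = {}" using Cons.prems by (auto simp: not_less)
    then show ?thesis unfolding lsign_def e by simp
  qed
  moreover have "x \<in> U \<and> U - {x} = set xs \<longleftrightarrow> U = insert x (set xs)"
    using Cons.prems by auto
  ultimately show ?case using Cons by (auto simp: wedge_mult_nth)
qed (simp add: mat_nth)

lemma ordered_prod_wedge_empty: "ordered_prod wedge S $ U $ {} = (if U = S then 1 else 0)"
  unfolding ordered_prod_def by (subst foldr_wedge_empty) auto

lemma normal_empty:
  "normal S T $ U $ {} = (if T = {} then if S = U then 1 else 0 else 0)"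
proof (cases "T = {}")
  case True
  then show ?thesis by (simp add: normal_def ordered_prod_def[of _ "{}"] ordered_prod_wedge_empty)
next
  case False
  then show ?thesis using normal_nth[of S T, where 'a = 'a] by (auto split: if_splits)
qed

text \<open>Contractions kill 1, so the coordinates with \<open>T = {}\<close> are the entries of
  the column of 1. This connects \<open>pr\<close>, which sees matrix entries, with
  bidegrees.\<close>

lemma normal_coeff_empty: "normal_coeff f U {} = f $ U $ {}"
proof -
  have "f $ U $ {} = (\<Sum>S\<in>UNIV. \<Sum>T\<in>UNIV. normal_coeff f S T * normal S T $ U $ {})"
    by (subst (1) normal_expansion[of f]) simp
  then show ?thesis
    by (simp add: normal_empty if_distrib[of "\<lambda>x. _ * x"] cong: if_cong)
qed

lemma pr_nth: "pr f $ U = mcoeff (f $ U $ {}) {#}"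
proof -
  have "(f *v axis {} 1) $ U = f $ U $ {}"
    by (simp add: matrix_vector_mult_def axis_def if_distrib[of "\<lambda>x. _ * x"] cong: if_cong)
  then show ?thesis by (simp add: pr_def)
qed

lemma ker_pr_iff: "f \<in> ker_pr \<longleftrightarrow> (\<forall>U. mcoeff (f $ U $ {}) {#} = 0)"
  by (simp add: ker_pr_def vec_eq_iff pr_nth)

lemma pr_add [simp]: "pr (f + g) = pr f + pr g" and pr_0 [simp]: "pr 0 = 0"
  by (simp_all add: vec_eq_iff pr_nth)

lemma pr_sum: "pr (sum f A) = (\<Sum>x\<in>A. pr (f x))"
  by (induction A rule: infinite_finite_induct) auto

lemma pr_mat: "pr (mat r) = axis {} (mcoeff r {#})"
  by (simp add: vec_eq_iff pr_nth mat_nth axis_def)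

lemma ker_pr_closed:
  "0 \<in> ker_pr" "f \<in> ker_pr \<Longrightarrow> g \<in> ker_pr \<Longrightarrow> f + g \<in> ker_pr"
  "f \<in> ker_pr \<Longrightarrow> - f \<in> ker_pr" "f \<in> ker_pr \<Longrightarrow> g \<in> ker_pr \<Longrightarrow> f - g \<in> ker_pr"
  by (simp_all add: ker_pr_iff)

section \<open>The integer grading\<close>

definition deg_part :: "int \<Rightarrow> ('a::comm_ring_1, 'n::finite) endo \<Rightarrow> ('a, 'n) endo" where
  "deg_part d f = (\<chi> U W. if int (card U) - int (card W) = d then f $ U $ W else 0)"

lemma deg_part_simps [simp]:
  "deg_part d 0 = 0" "deg_part d (f + g) = deg_part d f + deg_part d g"
  "deg_part d (r *e f) = r *e deg_part d f"
  by (auto simp: deg_part_def vec_eq_iff)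

lemma deg_part_sum: "deg_part d (sum f A) = (\<Sum>x\<in>A. deg_part d (f x))"
  by (induction A rule: infinite_finite_induct) auto

lemma deg_part_normal:
  "deg_part d (normal S T) = (if int (card S) - int (card T) = d then normal S T else 0)"
proof -
  obtain s where s: "\<And>U W. (normal S T :: ('a, 'b) endo) $ U $ W =
       (if T \<subseteq> W \<and> S \<inter> (W - T) = {} \<and> U = S \<union> (W - T) then s W else 0)"
    using normal_nth[of S T, where 'a = 'a] by blast
  have "int (card (S \<union> (W - T))) - int (card W) = int (card S) - int (card T)"
    if "T \<subseteq> W" "S \<inter> (W - T) = {}" for W
  proof -
    have "card T \<le> card W" using that by (simp add: card_mono)
    then show ?thesis using that by (simp add: card_Un_disjoint card_Diff_subset)
  qed
  then show ?thesis by (auto simp: vec_eq_iff deg_part_def s)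
qed

lemma normal_coeff_deg_part:
  "normal_coeff (deg_part d f) S T =
    (if int (card S) - int (card T) = d then normal_coeff f S T else 0)"
proof (rule normal_coeffI)
  show "deg_part d f = (\<Sum>S\<in>UNIV. \<Sum>T\<in>UNIV.
      (if int (card S) - int (card T) = d then normal_coeff f S T else 0) *e normal S T)"
    by (subst normal_expansion[of f]) (auto simp: deg_part_sum deg_part_normal intro!: sum.cong)
qed

text \<open>Passes from coordinates in the basis \<open>normal S T\<close> to matrix entries, where
  degrees of products can be read off. Both describe the same grading because
  \<open>normal S T\<close> changes cardinalities by \<open>card S - card T\<close>.\<close>

lemma zdeg_iff: "f \<in> zdeg d \<longleftrightarrow> (\<forall>U W. f $ U $ W \<noteq> 0 \<longrightarrow> int (card U) - int (card W) = d)"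
proof -
  have "f \<in> zdeg d \<longleftrightarrow> deg_part d f = f"
  proof
    assume "f \<in> zdeg d"
    then show "deg_part d f = f"
      by (intro normal_coeff_inject) (auto simp: normal_coeff_deg_part zdeg_def)
  next
    assume "deg_part d f = f"
    then have "normal_coeff f S T = 0" if "int (card S) - int (card T) \<noteq> d" for S T
      using normal_coeff_deg_part[of d f S T] that by simp
    then show "f \<in> zdeg d"
      unfolding zdeg_def by blast
  qed
  also have "\<dots> \<longleftrightarrow> (\<forall>U W. f $ U $ W \<noteq> 0 \<longrightarrow> int (card U) - int (card W) = d)"
    by (auto simp: vec_eq_iff deg_part_def)
  finally show ?thesis .
qed

lemma zdeg_add: "f \<in> zdeg d \<Longrightarrow> g \<in> zdeg d \<Longrightarrow> f + g \<in> zdeg d"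
  unfolding zdeg_iff by (metis add.right_neutral vector_add_component)

lemma zdeg_eq_0:
  fixes f :: "('a::comm_ring_1, 'n::{finite,linorder}) endo"
  assumes "f \<in> zdeg d" "d < - int CARD('n)"
  shows "f = 0"
proof -
  have "f $ U $ W = 0" for U W
  proof -
    have "card W \<le> CARD('n)" by (simp add: card_mono)
    then have "int (card U) - int (card W) \<noteq> d" using assms(2) by linarith
    then show ?thesis using assms(1) by (auto simp: zdeg_iff)
  qed
  then show ?thesis by (simp add: vec_eq_iff)
qed

lemma deg_part_zdeg: "deg_part d f \<in> zdeg d"
  by (simp add: zdeg_iff deg_part_def)

lemma deg_part_ker_pr: "f \<in> ker_pr \<Longrightarrow> deg_part d f \<in> ker_pr"
  by (simp add: ker_pr_iff deg_part_def)

lemma sum_deg_part: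
  fixes f :: "('a::comm_ring_1, 'n::finite) endo"
  shows "f = (\<Sum>d\<in>{- int CARD('n)..int CARD('n)}. deg_part d f)"
proof -
  have "int (card U) - int (card W) \<in> {- int CARD('n)..int CARD('n)}" for U W :: "'n set"
  proof -
    have "card W \<le> CARD('n)" "card U \<le> CARD('n)" by (simp_all add: card_mono)
    then show ?thesis by simp
  qed
  then show ?thesis by (simp add: vec_eq_iff deg_part_def)
qed


lemma zdeg_mult:
  assumes "f \<in> zdeg d" "g \<in> zdeg e"
  shows "f ** g \<in> zdeg (d + e)"
  unfolding zdeg_iff
proof (intro allI impI)
  fix U W assume "(f ** g) $ U $ W \<noteq> 0"
  then obtain V where "f $ U $ V * g $ V $ W \<noteq> 0"
    unfolding matrix_mult_nth by (meson sum.not_neutral_contains_not_neutral)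
  then have "f $ U $ V \<noteq> 0" "g $ V $ W \<noteq> 0" by auto
  then show "int (card U) - int (card W) = d + e"
    using assms by (fastforce simp: zdeg_iff)
qed

lemma zdeg_diff: "f \<in> zdeg d \<Longrightarrow> g \<in> zdeg d \<Longrightarrow> f - g \<in> zdeg d"
  unfolding zdeg_iff by (metis diff_zero vector_minus_component)

lemma zdeg_sgn_twist: "f \<in> zdeg d \<Longrightarrow> sgn_twist f \<in> zdeg d"
  unfolding zdeg_iff sgn_twist_def by (simp, metis mult_zero_right)

lemma cliff_zdeg: "cliff (\<lambda>_. 0) g \<in> zdeg (- 1)"
  unfolding zdeg_iff
proof (intro allI impI)
  fix U W :: "'b set" assume "cliff (\<lambda>_. 0) g $ U $ W \<noteq> 0"
  then obtain i where "g i * contr i $ U $ W \<noteq> 0"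
    by (auto simp: cliff_def elim: sum.not_neutral_contains_not_neutral)
  then have "i \<notin> U" "W = insert i U" by (auto simp: contr_nth split: if_splits)
  then show "int (card U) - int (card W) = - 1" by simp
qed

lemma gcomm_cliff_zdeg: "f \<in> zdeg d \<Longrightarrow> gcomm f (cliff (\<lambda>_. 0) g) \<in> zdeg (d - 1)"
  unfolding gcomm_cliff
  using zdeg_mult[of f d _ "- 1", OF _ cliff_zdeg] zdeg_mult[OF cliff_zdeg zdeg_sgn_twist[of f d]]
  by (auto intro!: zdeg_diff simp: add.commute)

lemma gcomm_cliff_add:
  "gcomm (f + f') (cliff a g) = gcomm f (cliff a g) + gcomm f' (cliff a g)"
  by (simp add: gcomm_cliff mult_distribs)

lemma gcomm_cliff_sum:
  "gcomm (\<Sum>x\<in>A. r x *e f x) (cliff a g) = (\<Sum>x\<in>A. r x *e gcomm (f x) (cliff a g))"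
  by (simp add: gcomm_cliff mult_sum_left mult_sum_right sgn_twist_sum escale_diff sum_subtractf)

lemma gcomm_cliff_ker_pr:
  assumes "\<And>i. mcoeff (a i) {#} = 0" "\<And>i. mcoeff (g i) {#} = 0"
  shows "gcomm f (cliff a g) \<in> ker_pr"
  using cliff_const_0[of a g, OF assms]
  by (simp add: gcomm_cliff ker_pr_iff matrix_mult_nth)


section \<open>Elements of exterior degree zero\<close>

definition contractions :: "('a::comm_ring_1, 'n::{finite,linorder}) endo set" where
  "contractions = {f. \<forall>S T. S \<noteq> {} \<longrightarrow> normal_coeff f S T = 0}"

text \<open>Each factor of the product contributes one sign from the anticommuting contractions and
  another from \<open>sgn_twist\<close>; the two cancel.\<close>

lemma contr_foldr_commute:
  fixes xs :: "'n::{finite,linorder} list"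
  shows "(contr i :: ('a::comm_ring_1, 'n) endo) ** sgn_twist (foldr (\<lambda>i g. contr i ** g) xs (mat 1)) =
    foldr (\<lambda>i g. contr i ** g) xs (mat 1) ** contr i"
proof (induction xs)
  case (Cons x xs)
  let ?F = "foldr (\<lambda>i g. contr i ** g) xs (mat 1) :: ('a, 'n) endo"
  have "contr i ** sgn_twist (contr x ** ?F) = - (contr i ** contr x) ** sgn_twist ?F"
    by (simp add: sgn_twist_mult mult_assoc)
  also have "\<dots> = contr x ** (contr i ** sgn_twist ?F)"
    by (subst clifford(4)) (simp add: mult_assoc)
  also have "\<dots> = (contr x ** ?F) ** contr i"
    by (simp only: Cons.IH mult_assoc)
  finally show ?case by simp
qed simp

text \<open>The contractions form a graded commutative algebra, so commutators with
  \<open>w_check\<close> vanish on it. This is what reduces \<open>eta\<close> on scalars to its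
  first piece.\<close>

lemma gcomm_contractions:
  assumes "f \<in> contractions"
  shows "gcomm f (cliff (\<lambda>_. 0) g) = 0"
proof -
  have "gcomm (normal {} T) (cliff (\<lambda>_. 0) g) = 0" for T
    unfolding gcomm_cliff normal_def ordered_prod_def
    by (simp add: cliff_def mult_sum_left mult_sum_right contr_foldr_commute)
  moreover have e: "f = (\<Sum>T\<in>UNIV. normal_coeff f {} T *e normal {} T)"
  proof -
    have "f = (\<Sum>S\<in>UNIV. if S = {} then (\<Sum>T\<in>UNIV. normal_coeff f S T *e normal S T) else 0)"
      by (subst (1) normal_expansion[of f], rule sum.cong)
         (use assms in \<open>auto simp: contractions_def\<close>)
    then show ?thesis by simp
  qed
  ultimately show ?thesis by (subst e, subst gcomm_cliff_sum) simp
qed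


section \<open>The homotopies\<close>

lemma bold_v_cliff: "bold_v = cliff X (\<lambda>_. 0)"
  by (simp add: bold_v_def cliff_def)

lemma w_check_cliff: "w_check h w = cliff (\<lambda>_. 0) (w_comp h w)"
  by (simp add: w_check_def cliff_def)

lemma f_gen_cliff: "f_gen h w i = cliff (\<lambda>j. if j = i then 1 else 0) (lam h w i)"
proof -
  have "(\<Sum>j\<in>UNIV. (if j = i then 1 else 0) *e wedge j) =
      (\<Sum>j\<in>UNIV. if j = i then wedge j else 0 :: ('a, 'b) endo)"
    by (simp only: if_escale)
  then show ?thesis by (simp add: f_gen_def cliff_def sum.distrib)
qed

text \<open>The minus sign of \<open>d_fact\<close>, the twist in \<open>mu1\<close> and the parity
  sign of the commutator combine to reverse the order of the commutator.\<close>

lemma mu1_gcomm: "mu1 h w f = gcomm f (cliff X (w_comp h w))"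
proof -
  have d: "d_fact h w = - cliff X (w_comp h w)"
    by (simp add: d_fact_def bold_v_cliff w_check_cliff cliff_add)
  have "even_part g ** k - odd_part g ** k = sgn_twist g ** k" for g k :: "('a, 'b) endo"
  proof -
    have "even_part g - odd_part g = sgn_twist g"
      by (auto simp: vec_eq_iff even_part_def odd_part_def sgn_twist_def)
    then show ?thesis by (metis mult_distribs(3))
  qed
  moreover have "sgn_twist (sgn_twist f) = f"
    by (simp add: vec_eq_iff sgn_twist_def flip: mult.assoc power_add power_mult_distrib)
  ultimately show ?thesis
    by (simp add: mu1_def dg_diff_def gcomm_def d)
qed

text \<open>Applied to 1, a product of k generators reaches exterior degree k only if every factor
  acts by its wedge part, since each contraction loses degree. Hence the bound on
  \<open>card U\<close>.\<close>

lemma foldr_f_gen_empty: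
  fixes w :: "('a::comm_ring_1, 'n::{finite,linorder}) mfps"
  shows "card U \<ge> length xs \<Longrightarrow> foldr (\<lambda>i g. f_gen h w i ** g) xs (mat 1) $ U $ {} =
    foldr (\<lambda>i g. wedge i ** g) xs (mat 1) $ U $ {}"
proof (induction xs arbitrary: U)
  case (Cons x xs)
  let ?F = "foldr (\<lambda>i g. f_gen h w i ** g) xs (mat 1)"
  let ?W = "foldr (\<lambda>i g. wedge i ** g) xs (mat 1) :: ('a, 'n) endo"
  \<comment> \<open>A contraction would have to start from the row \<open>insert j U\<close>, whose
    degree exceeds the number of remaining factors.\<close>
  have large: "?W $ V $ {} = 0" if "card V > length xs" for V
    using that
  proof (induction xs arbitrary: V)
    case (Cons y ys)
    then have "card (V - {y}) > length ys" by (cases "y \<in> V") auto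
    then have "foldr (\<lambda>i g. wedge i ** g) ys (mat 1) $ (V - {y}) $ {} = (0 :: ('a, 'n) mfps)"
      by (rule Cons.IH)
    then show ?case by (simp add: wedge_mult_nth)
  qed (auto simp: mat_nth)
  have "(contr j ** ?F) $ U $ {} = 0" for j
    using Cons.prems Cons.IH[of "insert j U"] large[of "insert j U"]
    by (auto simp: contr_mult_nth)
  moreover have "(wedge x ** ?F) $ U $ {} = (wedge x ** ?W) $ U $ {}"
    using Cons.prems Cons.IH[of "U - {x}"] by (auto simp: wedge_mult_nth)
  ultimately show ?case
    by (simp add: f_gen_def mult_distribs mult_sum_left)
qed simp

text \<open>In the column of 1 the projection to total degree \<open>card S\<close> keeps exactly
  the rows of that size, where the generators act like wedges.\<close>

lemma pr_incl [simp]: "pr (incl h w a) = a"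
proof -
  have "total_part (card S) (ordered_prod (f_gen h w) S) $ U $ {} = (if U = S then 1 else 0)" for S U
  proof (cases "card U = card S")
    case True
    then have "ordered_prod (f_gen h w) S $ U $ {} = ordered_prod wedge S $ U $ {}"
      unfolding ordered_prod_def by (intro foldr_f_gen_empty) simp
    then show ?thesis using True
      by (simp add: normal_coeff_empty[symmetric]) (simp add: normal_coeff_empty ordered_prod_wedge_empty)
  qed (auto simp: normal_coeff_empty[symmetric])
  then show ?thesis
    by (simp add: vec_eq_iff pr_nth incl_def if_distrib[of "\<lambda>x. mcoeff x _"]
        if_distrib[of "\<lambda>x. _ * x"] cong: if_cong)
qed

lemma incl_add: "incl h w (a + b) = incl h w a + incl h w b"
  by (simp add: incl_def Const_add escale_add sum.distrib)

lemma incl_axis: "incl h w (axis S c) = Const c *e total_part (card S) (ordered_prod (f_gen h w) S)"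
proof -
  have "incl h w (axis S c) = (\<Sum>T\<in>UNIV. if T = S then
      Const c *e total_part (card S) (ordered_prod (f_gen h w) S) else 0)"
    unfolding incl_def by (rule sum.cong) (auto simp: axis_def)
  then show ?thesis by simp
qed

lemma incl_axis_empty: "incl h w (axis {} c) = mat (Const c)"
proof -
  have "total_part 0 (mat 1) = (mat 1 :: ('a, 'b) endo)"
    by (rule normal_coeff_inject) auto
  then show ?thesis by (simp add: incl_axis ordered_prod_def) (rule mat_escale[symmetric])
qed

lemma incl_axis_single: "incl h w (axis {i} 1) = f_gen h w i"
proof -
  have "total_part 1 (f_gen h w i) = f_gen h w i"
    unfolding f_gen_cliff
    by (rule normal_coeff_inject) (auto simp: normal_coeff_cliff intro!: sum.neutral)
  then show ?thesis by (simp add: incl_axis ordered_prod_def)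
qed


section \<open>Consequences of the axioms of the Koszul homotopy\<close>

locale koszul =
  fixes h :: "('a::comm_ring_1, 'n::{finite,linorder}) endo \<Rightarrow> ('a, 'n) endo"
    and w :: "('a, 'n) mfps"
  assumes homotopy: "koszul_homotopy h" and potential: "w \<in> max_ideal_sq"
begin

lemma h_ker_pr: "f \<in> ker_pr \<Longrightarrow> h f \<in> ker_pr"
  and h_add: "f \<in> ker_pr \<Longrightarrow> g \<in> ker_pr \<Longrightarrow> h (f + g) = h f + h g"
  and h_zdeg: "f \<in> ker_pr \<Longrightarrow> f \<in> zdeg d \<Longrightarrow> h f \<in> zdeg (d - 1)"
  and h_K_part: "s \<ge> 1 \<Longrightarrow> f \<in> ker_pr \<Longrightarrow> K_part s q (h f) = h (K_part s q f)"
  and h_homotopy: "f \<in> ker_pr \<Longrightarrow> d1 (h f) + h (d1 f) = - f"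
  using homotopy by (auto simp: koszul_homotopy_def)

lemma h_0: "h 0 = 0"
  using h_add[of 0 0] by (simp add: ker_pr_closed)

text \<open>Locality of \<open>h\<close>: a coordinate of \<open>h f\<close> in one summand
  \<open>K s q\<close> depends only on the component of \<open>f\<close> in the same
  summand.\<close>

lemma h_normal_coeff_0:
  assumes "f \<in> ker_pr"
    and "\<And>S' T' m'. card S' = card S \<Longrightarrow> size m' + card T' = size m + card T \<Longrightarrow>
      mcoeff (normal_coeff f S' T') m' = 0"
  shows "mcoeff (normal_coeff (h f) S T) m = 0"
proof (cases "size m + card T = 0")
  \<comment> \<open>Compatibility with \<open>K_part\<close> starts at s = 1. The coordinates at s =
    0 are those that \<open>pr\<close> sees.\<close>
  case True
  then have "m = {#}" "T = {}" by simp_all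
  then show ?thesis using h_ker_pr[OF assms(1)] by (simp add: normal_coeff_empty ker_pr_iff)
next
  case False
  have "K_part (size m + card T) (card S) f = 0"
    by (rule normal_coeff_inject) (auto simp: mfps_eq_iff assms(2))
  then have "K_part (size m + card T) (card S) (h f) = 0"
    using False by (subst h_K_part[OF _ assms(1)]) (auto simp: h_0 Suc_le_eq nonempty_has_size)
  then have "mcoeff (normal_coeff (K_part (size m + card T) (card S) (h f)) S T) m = 0"
    by (simp only: normal_coeff_0 mcoeff_simps)
  then show ?thesis by simp
qed

lemma h_contractions:
  assumes "f \<in> ker_pr" "f \<in> contractions"
  shows "h f \<in> contractions"
proof -
  have "mcoeff (normal_coeff (h f) S T) m = 0" if "S \<noteq> {}" for S T m
  proof (rule h_normal_coeff_0[OF assms(1)])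
    fix S' T' :: "'n set" and m' :: "'n multiset"
    assume "card S' = card S"
    then have "S' \<noteq> {}" using that by auto
    then show "mcoeff (normal_coeff f S' T') m' = 0"
      using assms(2) by (simp add: contractions_def)
  qed
  then show ?thesis by (simp add: contractions_def mfps_eq_iff)
qed

lemma mat_ker_pr: "mat r \<in> ker_pr \<longleftrightarrow> mcoeff r {#} = 0"
  by (auto simp: ker_pr_iff mat_nth)

lemma mat_contractions: "mat r \<in> contractions"
  by (simp add: contractions_def)

lemma mat_zdeg: "mat r \<in> zdeg 0"
  by (simp add: zdeg_iff mat_nth)

text \<open>Scalars have q = 0, which \<open>h\<close> preserves, and degree 0, which it lowers to
  -1. Only bidegree (0, 1) is left.\<close>

lemma h_mat:
  assumes "mcoeff r {#} = 0"
  shows "h (mat r) = cliff (\<lambda>_. 0) (\<lambda>i. m_coeff h i r)"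
proof (rule normal_coeff_inject)
  fix S T :: "'n set"
  have "mat r \<in> ker_pr" using assms by (simp add: mat_ker_pr)
  then have c: "h (mat r) \<in> contractions" and z: "h (mat r) \<in> zdeg (- 1)"
    using h_contractions[OF _ mat_contractions] h_zdeg[OF _ mat_zdeg] by auto
  show "normal_coeff (h (mat r)) S T = normal_coeff (cliff (\<lambda>_. 0) (\<lambda>i. m_coeff h i r)) S T"
  proof (cases "S = {} \<and> card T = 1")
    case True
    then obtain j where "T = {j}" by (auto simp: card_1_singleton_iff)
    then show ?thesis using True by (simp add: normal_coeff_cliff m_coeff_def)
  next
    case False
    then have "normal_coeff (h (mat r)) S T = 0"
    proof (cases "S = {}")
      case True
      then have "int (card S) - int (card T) \<noteq> - 1" using False by simp
      then show ?thesis using z by (auto simp: zdeg_def)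
    qed (use c in \<open>simp add: contractions_def\<close>)
    moreover have "normal_coeff (cliff (\<lambda>_. 0) (\<lambda>i. m_coeff h i r)) S T = 0"
      using False by (auto simp: normal_coeff_cliff split: if_splits intro!: sum.neutral)
    ultimately show ?thesis by simp
  qed
qed

section \<open>Difference quotients attached to the homotopy\<close>

definition D :: "'n \<Rightarrow> ('a, 'n) mfps \<Rightarrow> ('a, 'n) mfps" where
  "D i r = - m_coeff h i (r - Const (mcoeff r {#}))"

text \<open>The homotopy equation on a scalar: \<open>d1\<close> kills scalars, and on a combination
  of the \<open>contr i\<close> it is the pairing with the coordinates.\<close>

lemma sum_X_D: "(\<Sum>i\<in>UNIV. X i * D i r) = r - Const (mcoeff r {#})"
proof -
  let ?r = "r - Const (mcoeff r {#})" and ?c = "cliff (\<lambda>_. 0) (\<lambda>i. - D i r)"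
  have k: "mat ?r \<in> ker_pr" by (simp add: mat_ker_pr)
  have "h (mat ?r) = ?c"
    by (simp add: h_mat D_def)
  moreover have "d1 (mat ?r) = 0"
    by (simp add: d1_def bold_v_cliff gcomm_cliff)
  moreover have "d1 ?c = - mat (\<Sum>i\<in>UNIV. X i * D i r)"
    using cliff_anticommute[of "\<lambda>_. 0" "\<lambda>i. - D i r" X "\<lambda>_. 0"]
    by (simp add: d1_def bold_v_cliff gcomm_cliff sum_negf mat_minus)
  ultimately have "mat (\<Sum>i\<in>UNIV. X i * D i r) = (mat ?r :: ('a, 'n) endo)"
    using h_homotopy[OF k] by (simp add: h_0)
  from arg_cong[OF this, of "\<lambda>f. f $ {} $ {}"] show ?thesis
    by (simp only: mat_nth refl if_True)
qed

lemma mcoeff_D: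
  assumes "m \<noteq> {#}"
  shows "mcoeff r m = (\<Sum>i\<in>set_mset m. mcoeff (D i r) (m - {#i#}))"
proof -
  have "mcoeff r m = mcoeff (\<Sum>i\<in>UNIV. X i * D i r) m"
    using assms by (simp only: sum_X_D) simp
  also have "\<dots> = (\<Sum>i\<in>UNIV. if i \<in># m then mcoeff (D i r) (m - {#i#}) else 0)"
    by (simp add: mcoeff_X_times)
  also have "\<dots> = (\<Sum>i\<in>set_mset m. mcoeff (D i r) (m - {#i#}))"
    by (simp flip: sum.inter_filter)
  finally show ?thesis .
qed

lemma w_coeff_0: "size m < 2 \<Longrightarrow> mcoeff w m = 0"
  using potential by (rule max_ideal_sq_mcoeff)

lemma w_comp_D: "w_comp h w i = D i w"
  by (simp add: w_comp_def D_def w_coeff_0)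

text \<open>The constant term of \<open>w_comp h w i\<close> is a coordinate in
  \<open>K 1 0\<close>, so it depends only on the linear terms of \<open>w\<close>, which
  vanish.\<close>

lemma w_comp_const_0: "mcoeff (w_comp h w i) {#} = 0"
  unfolding w_comp_def m_coeff_def
  by (simp, rule h_normal_coeff_0) (auto simp: mat_ker_pr w_coeff_0)

lemma lam_D: "lam h w i j = - D j (D i w)"
  using w_comp_const_0[of i] by (simp add: lam_def w_comp_D) (simp add: D_def)

lemma d_minus1_ker_pr: "d_minus1 h w f \<in> ker_pr"
  unfolding d_minus1_def w_check_cliff by (rule gcomm_cliff_ker_pr) (simp_all add: w_comp_const_0)

lemma d_minus1_add: "d_minus1 h w (f + g) = d_minus1 h w f + d_minus1 h w g"
  by (simp add: d_minus1_def w_check_cliff gcomm_cliff_add)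

lemma d_minus1_zdeg: "f \<in> zdeg d \<Longrightarrow> d_minus1 h w f \<in> zdeg (d - 1)"
  by (simp add: d_minus1_def w_check_cliff gcomm_cliff_zdeg)

lemma d_minus1_contractions: "f \<in> contractions \<Longrightarrow> d_minus1 h w f = 0"
  by (simp add: d_minus1_def w_check_cliff gcomm_contractions)

lemma mu1_ker_pr: "mu1 h w f \<in> ker_pr"
  unfolding mu1_gcomm by (rule gcomm_cliff_ker_pr) (simp_all add: w_comp_const_0)

lemma mu1_add: "mu1 h w (f + g) = mu1 h w f + mu1 h w g"
  by (simp add: mu1_gcomm gcomm_cliff_add)

section \<open>The perturbed homotopy\<close>

lemma eta_piece_ker_pr: "f \<in> ker_pr \<Longrightarrow> eta_piece h w j f \<in> ker_pr"
  by (induction j arbitrary: f) (auto intro: h_ker_pr ker_pr_closed d_minus1_ker_pr)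

lemma eta_piece_add:
  "f \<in> ker_pr \<Longrightarrow> g \<in> ker_pr \<Longrightarrow>
    eta_piece h w j (f + g) = eta_piece h w j f + eta_piece h w j g"
  by (induction j arbitrary: f g)
     (auto simp: h_add d_minus1_add h_ker_pr d_minus1_ker_pr add_ac)

lemma eta_piece_0: "eta_piece h w j 0 = 0"
  using eta_piece_add[of 0 0 j] by (simp add: ker_pr_closed)

text \<open>Additivity is available on \<open>ker_pr\<close>, so membership of the partial sums is
  carried through the same induction.\<close>

lemma eta_piece_sum:
  "(\<And>x. x \<in> A \<Longrightarrow> f x \<in> ker_pr) \<Longrightarrow>
    eta_piece h w j (sum f A) = (\<Sum>x\<in>A. eta_piece h w j (f x)) \<and> sum f A \<in> ker_pr"
  by (induction A rule: infinite_finite_induct)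
     (auto simp: eta_piece_0 eta_piece_add ker_pr_closed)

lemma eta_piece_zdeg:
  "f \<in> ker_pr \<Longrightarrow> f \<in> zdeg d \<Longrightarrow> eta_piece h w j f \<in> zdeg (d - 2 * int j - 1)"
proof (induction j arbitrary: f d)
  case (Suc j)
  have hf: "h f \<in> ker_pr" "h f \<in> zdeg (d - 1)" using Suc.prems h_ker_pr h_zdeg by auto
  show ?case
    using d_minus1_zdeg[OF Suc.IH[OF hf]] Suc.IH[OF d_minus1_ker_pr d_minus1_zdeg[OF hf(2)]]
    by (auto intro!: zdeg_add simp: algebra_simps)
qed (simp add: h_zdeg)

text \<open>With n variables, degrees lie between -n and n. Piece j lowers them by 2j + 1, hence
  maps below -n once j is at least n. Thus \<open>Sum_any\<close> in \<open>eta_tilde\<close> is a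
  genuine finite sum on \<open>ker_pr\<close> and not its default value 0.\<close>

lemma eta_piece_vanishes:
  assumes "f \<in> ker_pr" "j \<ge> CARD('n)"
  shows "eta_piece h w j f = 0"
proof -
  let ?A = "{- int CARD('n)..int CARD('n)}"
  have "eta_piece h w j (deg_part d f) = 0" if "d \<in> ?A" for d
    by (rule zdeg_eq_0[OF eta_piece_zdeg[OF deg_part_ker_pr deg_part_zdeg]]) (use that assms in auto)
  then have "eta_piece h w j (\<Sum>d\<in>?A. deg_part d f) = 0"
    using eta_piece_sum[of ?A "\<lambda>d. deg_part d f" j] deg_part_ker_pr[OF assms(1)] by simp
  then show ?thesis by (simp flip: sum_deg_part)
qed

lemma eta_tilde_sum: "f \<in> ker_pr \<Longrightarrow> eta_tilde h w f = (\<Sum>j<CARD('n). eta_piece h w j f)"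
  unfolding eta_tilde_def
  by (rule Sum_any.expand_superset) (auto simp: not_le[symmetric] dest: eta_piece_vanishes)

lemma eta_tilde_ker_pr: "f \<in> ker_pr \<Longrightarrow> eta_tilde h w f \<in> ker_pr"
proof -
  assume f: "f \<in> ker_pr"
  have "(\<Sum>j\<in>A. eta_piece h w j f) \<in> ker_pr" for A
    by (induction A rule: infinite_finite_induct) (auto simp: ker_pr_closed eta_piece_ker_pr f)
  then show ?thesis by (simp add: eta_tilde_sum f)
qed

lemma eta_tilde_add:
  "f \<in> ker_pr \<Longrightarrow> g \<in> ker_pr \<Longrightarrow> eta_tilde h w (f + g) = eta_tilde h w f + eta_tilde h w g"
  by (simp add: eta_tilde_sum ker_pr_closed eta_piece_add sum.distrib)

lemma eta_tilde_0: "eta_tilde h w 0 = 0"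
  using eta_tilde_add[of 0 0] by (simp add: ker_pr_closed)

lemma eta_ker_add:
  "f \<in> ker_pr \<Longrightarrow> g \<in> ker_pr \<Longrightarrow> eta_ker h w (f + g) = eta_ker h w f + eta_ker h w g"
  by (simp add: eta_ker_def eta_tilde_add eta_tilde_ker_pr mu1_add mu1_ker_pr numeral_3_eq_3)

lemma incl_complement_ker_pr: "f - incl h w (pr f) \<in> ker_pr"
proof -
  have "pr (f - incl h w (pr f)) + pr (incl h w (pr f)) = pr f"
    by (simp flip: pr_add del: pr_incl)
  then show ?thesis by (simp add: ker_pr_def)
qed

text \<open>Allows \<open>eta\<close> to be applied to a sum over words, which is scalar although
  its terms need not be.\<close>

lemma eta_add: "eta h w (f + g) = eta h w f + eta h w g"
proof -
  have "f + g - incl h w (pr (f + g)) = (f - incl h w (pr f)) + (g - incl h w (pr g))"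
    by (simp add: incl_add)
  then show ?thesis
    unfolding eta_def by (simp only: eta_ker_add incl_complement_ker_pr)
qed

lemma eta_0: "eta h w 0 = 0"
  using eta_add[of 0 0] by simp

lemma eta_sum: "eta h w (sum f A) = (\<Sum>x\<in>A. eta h w (f x))"
  by (induction A rule: infinite_finite_induct) (auto simp: eta_0 eta_add)

text \<open>\<open>h\<close> stays among the contractions and \<open>d_minus1\<close> kills these,
  so both summands of the recursion vanish.\<close>

lemma eta_piece_contractions:
  "f \<in> ker_pr \<Longrightarrow> f \<in> contractions \<Longrightarrow> eta_piece h w (Suc j) f = 0"
proof (induction j arbitrary: f)
  case 0
  then show ?case by (simp add: d_minus1_contractions h_contractions h_ker_pr h_0)
next
  case (Suc j)
  have "eta_piece h w (Suc (Suc j)) f =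
      d_minus1 h w (eta_piece h w (Suc j) (h f)) + eta_piece h w (Suc j) (d_minus1 h w (h f))"
    by simp
  also have "\<dots> = d_minus1 h w 0 + eta_piece h w (Suc j) 0"
    using Suc by (simp only: h_ker_pr h_contractions d_minus1_contractions)
  also have "\<dots> = 0"
    by (simp only: eta_piece_0) (simp add: d_minus1_contractions contractions_def)
  finally show ?case .
qed

lemma eta_mat: "eta h w (mat r) = cliff (\<lambda>_. 0) (\<lambda>i. - D i r)"
proof -
  let ?r = "r - Const (mcoeff r {#})"
  have k: "mat ?r \<in> ker_pr" by (simp add: mat_ker_pr)
  \<comment> \<open>The constant term lies in the image of \<open>incl\<close> and is projected
    away.\<close>
  have "eta h w (mat r) = eta_ker h w (mat ?r)"
    by (simp add: eta_def pr_mat incl_axis_empty mat_diff)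
  \<comment> \<open>Scalars are closed under \<open>mu1\<close>, so the correction by the cube of
    \<open>eta_tilde\<close> vanishes.\<close>
  also have "\<dots> = eta_tilde h w (mat ?r)"
    by (simp add: eta_ker_def mu1_gcomm gcomm_cliff eta_tilde_0 numeral_3_eq_3)
  also have "\<dots> = (\<Sum>j\<in>{0}. eta_piece h w j (mat ?r))"
    unfolding eta_tilde_def
  proof (rule Sum_any.expand_superset)
    show "{j. eta_piece h w j (mat ?r) \<noteq> 0} \<subseteq> {0}"
      using eta_piece_contractions[OF k mat_contractions] by (metis (mono_tags, lifting)
        mem_Collect_eq not0_implies_Suc singletonI subsetI)
  qed simp
  also have "\<dots> = cliff (\<lambda>_. 0) (\<lambda>i. - D i r)"
    by (simp add: h_mat D_def)
  finally show ?thesis .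
qed


section \<open>Sums over words with a given content\<close>

text \<open>\<open>taylor m\<close> is the coefficient of the monomial \<open>m\<close> in \<open>\<Sum>\<^sub>k (\<Sum>\<^sub>i y\<^sub>i D\<^sub>i)\<^sup>k w\<close>.\<close>

function taylor :: "'n multiset \<Rightarrow> ('a, 'n) mfps" where
  "taylor m = (if m = {#} then w else \<Sum>i\<in>set_mset m. D i (taylor (m - {#i#})))"
  by pat_completeness auto
termination
  by (relation "measure size") (auto simp: size_Diff1_less)

declare taylor.simps [simp del]

text \<open>The k-fold iteration of \<open>mcoeff_D\<close>: \<open>a\<close> collects the letters
  split off so far and \<open>m - a\<close> is the monomial still to be read. Before each further
  step this rest is nonempty, so constant terms never enter.\<close>

lemma mcoeff_w_taylor:
  "k \<le> size m \<Longrightarrow> mcoeff w m = (\<Sum>a | a \<subseteq># m \<and> size a = k. mcoeff (taylor a) (m - a))"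
proof (induction k)
  case 0
  have "{a. a \<subseteq># m \<and> size a = 0} = {{#}}" by auto
  then show ?case by (simp add: taylor.simps)
next
  case (Suc k)
  have fin: "finite {a. a \<subseteq># m \<and> size a = l}" for l
    by (rule finite_subset[OF _ finite_submultisets[of m]]) auto
  have "mcoeff w m = (\<Sum>a | a \<subseteq># m \<and> size a = k. mcoeff (taylor a) (m - a))"
    using Suc by simp
  also have "\<dots> = (\<Sum>a | a \<subseteq># m \<and> size a = k. \<Sum>i\<in>set_mset (m - a).
      mcoeff (D i (taylor a)) (m - a - {#i#}))"
  proof (intro sum.cong refl mcoeff_D)
    fix a assume "a \<in> {a. a \<subseteq># m \<and> size a = k}"
    then show "m - a \<noteq> {#}" using Suc.prems by (auto simp: Diff_eq_empty_iff_mset dest!: size_mset_mono)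
  qed
  also have "\<dots> = (\<Sum>(a, i)\<in>(SIGMA a:{a. a \<subseteq># m \<and> size a = k}. set_mset (m - a)).
      mcoeff (D i (taylor a)) (m - a - {#i#}))"
    by (rule sum.Sigma) (simp_all add: fin)
  also have "\<dots> = (\<Sum>(a, i)\<in>(SIGMA a:{a. a \<subseteq># m \<and> size a = Suc k}. set_mset a).
      mcoeff (D i (taylor (a - {#i#}))) (m - a))"
  \<comment> \<open>A letter \<open>i\<close> taken from the rest joins \<open>a\<close>; afterwards
    the sum over the letters of \<open>a\<close> is the recursion of \<open>taylor\<close>.\<close>
  proof (rule sum.reindex_bij_witness
      [where i = "\<lambda>(a, i). (a - {#i#}, i)" and j = "\<lambda>(a, i). (add_mset i a, i)"])
    fix z assume z: "z \<in> (SIGMA a:{a. a \<subseteq># m \<and> size a = k}. set_mset (m - a))"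
    then obtain a i where ai: "z = (a, i)" "a \<subseteq># m" "size a = k" "i \<in># m - a" by auto
    obtain c where c: "m = a + c" using ai by (metis subset_mset.add_diff_inverse)
    then obtain c' where "c = add_mset i c'" using ai by (auto dest: multi_member_split)
    then have "add_mset i a \<subseteq># m" using c by simp
    then show "(case z of (a, i) \<Rightarrow> (add_mset i a, i)) \<in>
        (SIGMA a:{a. a \<subseteq># m \<and> size a = Suc k}. set_mset a)"
      using ai by simp
    show "(case (case z of (a, i) \<Rightarrow> (add_mset i a, i)) of (a, i) \<Rightarrow> (a - {#i#}, i)) = z"
      using ai by simp
    show "(case (case z of (a, i) \<Rightarrow> (add_mset i a, i)) of
        (a, i) \<Rightarrow> mcoeff (D i (taylor (a - {#i#}))) (m - a)) =
        (case z of (a, i) \<Rightarrow> mcoeff (D i (taylor a)) (m - a - {#i#}))"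
      using ai by simp
  next
    fix z assume z: "z \<in> (SIGMA a:{a. a \<subseteq># m \<and> size a = Suc k}. set_mset a)"
    then obtain a i where ai: "z = (a, i)" "a \<subseteq># m" "size a = Suc k" "i \<in># a" by auto
    then obtain b where b: "a = add_mset i b" by (meson multi_member_split)
    obtain c where c: "m = a + c" using ai by (metis subset_mset.add_diff_inverse)
    show "(case z of (a, i) \<Rightarrow> (a - {#i#}, i)) \<in> (SIGMA a:{a. a \<subseteq># m \<and> size a = k}. set_mset (m - a))"
      using ai b c by simp
    show "(case (case z of (a, i) \<Rightarrow> (a - {#i#}, i)) of (a, i) \<Rightarrow> (add_mset i a, i)) = z"
      using ai by simp
  qed
  also have "\<dots> = (\<Sum>a | a \<subseteq># m \<and> size a = Suc k. \<Sum>i\<in>set_mset a.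
      mcoeff (D i (taylor (a - {#i#}))) (m - a))"
    by (rule sum.Sigma[symmetric]) (simp_all add: fin)
  also have "\<dots> = (\<Sum>a | a \<subseteq># m \<and> size a = Suc k. mcoeff (taylor a) (m - a))"
    by (intro sum.cong refl) (subst (2) taylor.simps, auto)
  finally show ?case .
qed

text \<open>The case k = \<open>size m\<close> of the expansion: only \<open>a = m\<close> is left
  and the whole monomial has been read.\<close>

lemma taylor_const: "mcoeff (taylor m) {#} = mcoeff w m"
proof -
  have "a = m" if "a \<subseteq># m" "size a = size m" for a
  proof (rule ccontr)
    assume "a \<noteq> m"
    then have "a \<subset># m" using that(1) by (simp add: subset_mset.less_le)
    then show False using that(2) mset_subset_size by fastforce
  qed
  then have "{a. a \<subseteq># m \<and> size a = size m} = {m}" by auto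
  then show ?thesis using mcoeff_w_taylor[of "size m" m] by simp
qed

section \<open>Tree formulas summed over words\<close>

definition words :: "'n multiset \<Rightarrow> 'n list set" where
  "words m = {is. mset is = m}"

lemma finite_words: "finite (words m)"
proof (rule finite_subset)
  show "words m \<subseteq> {is. set is \<subseteq> UNIV \<and> length is = size m}" by (auto simp: words_def)
qed (rule finite_lists_length_eq, simp)

definition p_word :: "'n list \<Rightarrow> ('a, 'n) endo" where
  "p_word is = p_op (eta h w) (map (f_gen h w) is)"

text \<open>Absorbs the convention for single inputs, so that the recursion treats both factors
  alike.\<close>

definition eta_p_word :: "'n list \<Rightarrow> ('a, 'n) endo" where
  "eta_p_word is = (if length is = 1 then f_gen h w (hd is) else eta h w (p_word is))"

lemma p_word_rec:
  "p_word is = (\<Sum>j\<in>{1..<length is}. mu2 (eta_p_word (take (length is - j) is))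
    (eta_p_word (drop (length is - j) is)))"
proof -
  \<comment> \<open>A right factor of length one is the last letter, which is the head of the
    dropped list.\<close>
  have "hd (map (f_gen h w) is) = f_gen h w (hd is)"
    "last (map (f_gen h w) is) = f_gen h w (hd (drop (length is - 1) is))" if "is \<noteq> []"
    using that by (simp_all add: hd_map last_map last_conv_nth hd_drop_conv_nth)
  then show ?thesis
    unfolding p_word_def p_op.simps[of _ "map _ is"] eta_p_word_def
    by (cases "is = []", simp, intro sum.cong refl) (auto simp: take_map drop_map)
qed

text \<open>A word with a cut point is a pair of nonempty words whose contents add up to
  \<open>m\<close>; bilinearity of \<open>mu2\<close> then sums the two halves
  independently.\<close>

lemma sum_p_word_rec:
  "(\<Sum>is\<in>words m. p_word is) = (\<Sum>(a, b) | a + b = m \<and> (a \<noteq> {#} \<and> b \<noteq> {#}).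
     mu2 (\<Sum>is\<in>words a. eta_p_word is) (\<Sum>is\<in>words b. eta_p_word is))"
proof -
  let ?S = "{(a, b). a + b = m \<and> (a \<noteq> {#} \<and> b \<noteq> {#})}"
  let ?g = "\<lambda>us vs. mu2 (eta_p_word us) (eta_p_word vs)"
  have finS: "finite ?S"
    by (rule finite_subset[OF _ finite_mset_splits[of m]]) auto
  have "(\<Sum>is\<in>words m. p_word is) =
      (\<Sum>(is, j)\<in>(SIGMA is:words m. {1..<length is}). ?g (take (length is - j) is) (drop (length is - j) is))"
    by (subst p_word_rec) (simp add: sum.Sigma finite_words)
  also have "\<dots> = (\<Sum>((a, b), (us, vs))\<in>(SIGMA p:?S. words (fst p) \<times> words (snd p)). ?g us vs)"
    by (rule sum.reindex_bij_witness
        [where i = "\<lambda>((a, b), (us, vs)). (us @ vs, length vs)"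
           and j = "\<lambda>(is, j). let us = take (length is - j) is; vs = drop (length is - j) is
                in ((mset us, mset vs), (us, vs))"])
       (auto simp: words_def Let_def Suc_le_eq simp flip: mset_append)
  also have "\<dots> = (\<Sum>p\<in>?S. \<Sum>(us, vs)\<in>words (fst p) \<times> words (snd p). ?g us vs)"
    by (subst sum.Sigma) (use finS in \<open>auto simp: finite_words case_prod_beta'\<close>)
  also have "\<dots> = (\<Sum>p\<in>?S. \<Sum>us\<in>words (fst p). \<Sum>vs\<in>words (snd p). ?g us vs)"
    by (simp add: sum.cartesian_product)
  also have "\<dots> = (\<Sum>(a, b)\<in>?S. mu2 (\<Sum>is\<in>words a. eta_p_word is) (\<Sum>is\<in>words b. eta_p_word is))"
    by (simp add: mu2_def mult_sum_left mult_sum_right sgn_twist_sum case_prod_beta')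
       (rule sum.cong[OF refl], rule sum.swap)
  finally show ?thesis .
qed

text \<open>One formula serves all sizes because the generator \<open>f_gen h w i\<close> already
  carries the contraction part \<open>- D j (D i w)\<close> that \<open>eta\<close> would produce
  from the scalar \<open>D i w\<close>; a wedge part occurs only for a single letter. The second
  claim starts at size 2, since \<open>p_op\<close> is an empty sum on shorter lists.\<close>

lemma sum_words:
  assumes "m \<noteq> {#}"
  shows "(\<Sum>is\<in>words m. eta_p_word is) =
      cliff (\<lambda>j. if m = {#j#} then 1 else 0) (\<lambda>j. - D j (taylor m)) \<and>
    (size m \<ge> 2 \<longrightarrow> (\<Sum>is\<in>words m. p_word is) = mat (taylor m))"
  using assms
proof (induction "size m" arbitrary: m rule: less_induct)
  case less
  show ?case
  proof (cases "size m = 1")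
    case True
    then obtain i where m: "m = {#i#}" using size_1_singleton_mset by blast
    have "words m = {[i]}" by (auto simp: words_def m)
    moreover have "taylor m = D i w" by (simp add: m taylor.simps)
    moreover have "(\<lambda>j. if m = {#j#} then 1 else 0) = (\<lambda>j. if j = i then 1 else (0 :: ('a, 'n) mfps))"
      by (auto simp: m)
    moreover have "lam h w i = (\<lambda>j. - D j (D i w))"
      by (simp add: fun_eq_iff lam_D)
    ultimately show ?thesis
      using True by (simp add: eta_p_word_def f_gen_cliff)
  next
    case False
    then have size: "size m \<ge> 2"
      using less.prems by (metis One_nat_def Suc_1 Suc_leI le_neq_implies_less nonempty_has_size)
    let ?P = "\<lambda>a b :: 'n multiset. a \<noteq> {#} \<and> b \<noteq> {#}"
    let ?S = "{(a, b). a + b = m \<and> ?P a b}"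
    let ?\<alpha> = "\<lambda>a j. if a = {#j#} then 1 else 0" and ?\<beta> = "\<lambda>a j. - D j (taylor a)"
    have finS: "finite ?S"
      by (rule finite_subset[OF _ finite_mset_splits[of m]]) auto
    have IH: "(\<Sum>is\<in>words a. eta_p_word is) = cliff (?\<alpha> a) (?\<beta> a) \<and>
        (\<Sum>is\<in>words b. eta_p_word is) = cliff (?\<alpha> b) (?\<beta> b)" if "(a, b) \<in> ?S" for a b
      using that less.hyps[of a] less.hyps[of b] by (auto simp: nonempty_has_size)
    have "(\<Sum>is\<in>words m. p_word is) =
        (\<Sum>(a, b)\<in>?S. mu2 (cliff (?\<alpha> a) (?\<beta> a)) (cliff (?\<alpha> b) (?\<beta> b)))"
      unfolding sum_p_word_rec by (rule sum.cong) (use IH in \<open>auto simp: case_prod_beta'\<close>)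
    \<comment> \<open>The right factors are odd, so the twist in \<open>mu2\<close> is a global
      sign. It cancels later against the sign in \<open>?\<beta>\<close>.\<close>
    also have "\<dots> = - (\<Sum>(a, b)\<in>?S. cliff (?\<alpha> a) (?\<beta> a) ** cliff (?\<alpha> b) (?\<beta> b))"
      by (simp add: mu2_def case_prod_beta' sum_negf)
    also have "\<dots> = mat (- (\<Sum>(a, b)\<in>?S. \<Sum>i\<in>UNIV. ?\<alpha> a i * ?\<beta> b i))"
      by (subst sum_cliff_products) (simp_all add: mat_minus)
    \<comment> \<open>The coefficient \<open>?\<alpha> a i\<close> is nonzero only for
      \<open>a = {#i#}\<close>, so the pairing leaves one letter \<open>i\<close> and the rest
      \<open>m - {#i#}\<close>, as in the recursion of \<open>taylor\<close>.\<close>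
    also have "- (\<Sum>(a, b)\<in>?S. \<Sum>i\<in>UNIV. ?\<alpha> a i * ?\<beta> b i) = taylor m"
    proof -
      have "- (\<Sum>(a, b)\<in>?S. \<Sum>i\<in>UNIV. ?\<alpha> a i * ?\<beta> b i) =
          (\<Sum>p\<in>?S. \<Sum>i\<in>UNIV. if fst p = {#i#} then D i (taylor (snd p)) else 0)"
        unfolding sum_negf[symmetric] case_prod_beta' by (intro sum.cong refl) auto
      also have "\<dots> = (\<Sum>i\<in>UNIV. \<Sum>p\<in>?S. if fst p = {#i#} then D i (taylor (snd p)) else 0)"
        by (rule sum.swap)
      also have "\<dots> = (\<Sum>i\<in>UNIV. if i \<in># m then D i (taylor (m - {#i#})) else 0)"
      proof (rule sum.cong[OF refl])
        fix i
        have "(\<Sum>p\<in>?S. if fst p = {#i#} then D i (taylor (snd p)) else 0) =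
            (\<Sum>p\<in>?S. if p = ({#i#}, m - {#i#}) then D i (taylor (m - {#i#})) else 0)"
          by (rule sum.cong) auto
        also have "\<dots> = (if ({#i#}, m - {#i#}) \<in> ?S then D i (taylor (m - {#i#})) else 0)"
          using finS by (rule sum.delta)
        \<comment> \<open>As \<open>m\<close> has at least two letters, the rest after removing one
          is nonempty.\<close>
        also have "({#i#}, m - {#i#}) \<in> ?S \<longleftrightarrow> i \<in># m"
        proof (cases "i \<in># m")
          case True
          then obtain b where "m = add_mset i b" by (meson multi_member_split)
          then show ?thesis using size by auto
        qed (simp add: diff_single_trivial)
        finally show "(\<Sum>p\<in>?S. if fst p = {#i#} then D i (taylor (snd p)) else 0) =
            (if i \<in># m then D i (taylor (m - {#i#})) else 0)" .
      qed
      also have "\<dots> = taylor m"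
        using less.prems by (subst taylor.simps) (simp flip: sum.inter_filter)
      finally show ?thesis .
    qed
    finally have P: "(\<Sum>is\<in>words m. p_word is) = mat (taylor m)" .
    have "(\<Sum>is\<in>words m. eta_p_word is) = (\<Sum>is\<in>words m. eta h w (p_word is))"
      using False by (intro sum.cong) (auto simp: eta_p_word_def words_def)
    also have "\<dots> = cliff (\<lambda>_. 0) (?\<beta> m)"
      by (simp add: eta_sum[symmetric] P eta_mat)
    also have "(\<lambda>_. 0) = ?\<alpha> m"
      using False by (auto simp: fun_eq_iff)
    finally show ?thesis using P by simp
  qed
qed

section \<open>The coefficients of the disc potential\<close>

lemma sum_mu_min:
  assumes "size m \<ge> 2"
  shows "(\<Sum>is\<in>words m. mu_min h w (map (\<lambda>i. axis {i} 1) (rev is))) = axis {} (mcoeff w m)"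
proof -
  have "(\<Sum>is\<in>words m. mu_min h w (map (\<lambda>i. axis {i} 1) (rev is))) =
      (\<Sum>is\<in>words m. pr (p_word (rev is)))"
    by (simp add: mu_min_def p_word_def incl_axis_single comp_def)
  \<comment> \<open>Reversal preserves the content of a word, so the order of the arguments
    disappears in the sum.\<close>
  also have "\<dots> = (\<Sum>is\<in>words m. pr (p_word is))"
    by (rule sum.reindex_bij_witness[where i = rev and j = rev]) (auto simp: words_def)
  also have "\<dots> = pr (mat (taylor m))"
    using assms sum_words[of m] by (force simp flip: pr_sum)
  finally show ?thesis by (simp add: pr_mat taylor_const)
qed

text \<open>A monomial determines the length of the words that contribute to it, so a single degree
  survives in the sum defining the potential.\<close>

lemma mcoeff_disc_part:
  "mcoeff (disc_part h w k $ S) m = (if k = size m then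
     (\<Sum>is\<in>words m. mu_min h w (map (\<lambda>i. axis {i} 1) (rev is))) $ S else 0)"
proof -
  have fin: "finite {is :: 'n list. length is = k}"
    using finite_lists_length_eq[of "UNIV :: 'n set" k] by simp
  have "mcoeff (disc_part h w k $ S) m = (\<Sum>is | length is = k.
      if mset is = m then mu_min h w (map (\<lambda>i. axis {i} 1) (rev is)) $ S else 0)"
    by (simp add: disc_part_def mcoeff_prod_list_X if_distrib[of "\<lambda>x. _ * x"] cong: if_cong)
  also have "\<dots> = (\<Sum>is | length is = k \<and> mset is = m.
      mu_min h w (map (\<lambda>i. axis {i} 1) (rev is)) $ S)"
    using fin by (simp flip: sum.inter_filter)
  also have "{is. length is = k \<and> mset is = m} = (if k = size m then words m else {})"
    by (auto simp: words_def)
  finally show ?thesis by simp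
qed

end

theorem theorem2:
  fixes w :: "('a::comm_ring_1, 'n::{finite,linorder}) mfps"
    and h :: "('a, 'n) endo \<Rightarrow> ('a, 'n) endo"
  assumes "w \<in> max_ideal_sq"
    and "koszul_homotopy h"
  shows "disc_potential h w = w *s axis {} 1"
proof -
  interpret koszul h w using assms by unfold_locales
  have "mcoeff (disc_potential h w $ S) m = mcoeff ((w *s axis {} 1) $ S) m" for S m
  proof (cases "size m \<ge> 2")
    case True
    then have "mcoeff (disc_potential h w $ S) m = axis {} (mcoeff w m) $ S"
      by (simp add: disc_potential_def mcoeff_disc_part sum_mu_min)
    then show ?thesis by (simp add: axis_def)
  next
    \<comment> \<open>Below degree 2 the range of k is empty and \<open>w\<close> has no
      terms.\<close>
    case False
    then show ?thesis by (simp add: disc_potential_def axis_def w_coeff_0)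
  qed
  then show ?thesis by (simp add: vec_eq_iff mfps_eq_iff)
qed

end
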